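(* Let $\mathcal{H}$ be a homogeneous foliation of degree $2$ on $\mathbb{P}^2_{\mathbb{C}}$, with line at infinity $L_\infty$. Then the $3$-web $\mathrm{Leg}(L_\infty\boxtimes\mathcal{H})$ is flat.
   Context: A foliation $\mathcal H$ of degree $2$ on $\mathbb{P}^2_{\mathbb{C}}$ is homogeneous if in some affine chart $(x,y)$ it is invariant under all homotheties $(x,y)\mapsto\lambda(x,y)$, $\lambda\in\mathbb{C}^*$; then it is defined in that chart by $A\,dx+B\,dy$ with $A,B\in\mathbb{C}[x,y]_{2}$ and $\gcd(A,B)=1$. $L_\infty$ is the line at infinity of that chart. $L_\infty\boxtimes\mathcal H$ denotes the pre-foliation of co-degree $1$ and degree $3$ given by the pair $(L_\infty,\mathcal H)$. Legendre transform. In the affine chart $(p,q)$ of $\check{\mathbb{P}}^2_{\mathbb{C}}$ associated to the line $\{y=px-q\}$, $\mathrm{Leg}\,\mathcal H$ is the $2$-web given by $A(x,px-q)+pB(x,px-q)=0$ with $x=dq/dp$. $\mathrm{Leg}\,L_\infty$ is the foliation of $\check{\mathbb{P}}^2_{\mathbb{C}}$ by lines through the point dual to $L_\infty$, i.e. $dp=0$, and $\mathrm{Leg}(L_\infty\boxtimes\mathcal H)=\mathrm{Leg}\,L_\infty\boxtimes\mathrm{Leg}\,\mathcal H$ is their superposition. Curvature. At a generic point a $3$-web is a superposition $\mathcal F_1\boxtimes\mathcal F_2\boxtimes\mathcal F_3$ of pairwise transverse foliations, $\mathcal F_i:\omega_i=0$. Put $\omega_i\wedge\omega_j=\delta_{ij}\,dx\wedge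 dy$ and let $\eta$ be the unique meromorphic 1-form with $d(\delta_{23}\omega_1)=\eta\wedge\delta_{23}\omega_1$, $d(\delta_{31}\omega_2)=\eta\wedge\delta_{31}\omega_2$, $d(\delta_{12}\omega_3)=\eta\wedge\delta_{12}\omega_3$. The curvature $K(\mathcal W)=d\eta$ is a well-defined global meromorphic 2-form; $\mathcal W$ is flat if $K(\mathcal W)\equiv0$. *)

theory Defs
  imports "HOL-Complex_Analysis.Complex_Analysis"
    "HOL-Computational_Algebra.Polynomial"
begin

section \<open>Foliations of the complex projective plane\<close>

text \<open>
  Polynomials in the homogeneous coordinates are represented by the functions they
  induce; this loses nothing over the infinite field of complex numbers.
\<close>

inductive polynomial_fun :: "(complex^3 \<Rightarrow> complex) \<Rightarrow> bool" where
  const: "polynomial_fun (\<lambda>v. c)"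
| coord: "polynomial_fun (\<lambda>v. v $ i)"
| add: "polynomial_fun f \<Longrightarrow> polynomial_fun g \<Longrightarrow> polynomial_fun (\<lambda>v. f v + g v)"
| mult: "polynomial_fun f \<Longrightarrow> polynomial_fun g \<Longrightarrow> polynomial_fun (\<lambda>v. f v * g v)"

definition homogeneous_poly :: "nat \<Rightarrow> (complex^3 \<Rightarrow> complex) \<Rightarrow> bool" where
  "homogeneous_poly n f \<longleftrightarrow> polynomial_fun f \<and> (\<forall>t v. f (t *s v) = t ^ n * f v)"

definition no_common_factor :: "(complex^3 \<Rightarrow> complex^3) \<Rightarrow> bool" where
  "no_common_factor \<omega> \<longleftrightarrow>
    (\<forall>g. polynomial_fun g \<and>
         (\<forall>i. \<exists>h. polynomial_fun h \<and> (\<forall>v. \<omega> v $ i = g v * h v))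
       \<longrightarrow> (\<exists>c. \<forall>v. g v = c))"

text \<open>
  A foliation of degree \<open>d\<close> is given by a homogeneous 1-form
  \<open>\<omega> = a dX + b dY + c dZ\<close> whose coefficients, listed as the vector \<open>\<omega> v\<close>, have degree
  \<open>d + 1\<close> and no common factor, and which satisfies the Euler relation
  \<open>a X + b Y + c Z = 0\<close>. Integrability is automatic in dimension two.
\<close>

definition foliation :: "nat \<Rightarrow> (complex^3 \<Rightarrow> complex^3) \<Rightarrow> bool" where
  "foliation d \<omega> \<longleftrightarrow>
     (\<forall>i. homogeneous_poly (d + 1) (\<lambda>v. \<omega> v $ i)) \<and>
     (\<forall>v. (\<Sum>i\<in>UNIV. \<omega> v $ i * v $ i) = 0) \<and>
     no_common_factor \<omega>"

text \<open>Two forms without common factor define the same foliation iff they are proportional.\<close>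

definition same_foliation :: "(complex^3 \<Rightarrow> complex^3) \<Rightarrow> (complex^3 \<Rightarrow> complex^3) \<Rightarrow> bool" where
  "same_foliation \<omega> \<omega>' \<longleftrightarrow> (\<exists>c. c \<noteq> 0 \<and> (\<forall>v. \<omega>' v = c *s \<omega> v))"

definition pullback :: "complex^3^3 \<Rightarrow> (complex^3 \<Rightarrow> complex^3) \<Rightarrow> complex^3 \<Rightarrow> complex^3" where
  "pullback M \<omega> v = transpose M *v \<omega> (M *v v)"

text \<open>
  An invertible matrix \<open>M\<close> encodes the affine chart in which the point with coordinates
  \<open>(x, y)\<close> is the class of \<open>M (x, y, 1)\<close>. A line of the plane is encoded by the coefficient
  vector of a linear form; \<open>line_at_infinity M\<close> is the linear form giving the third
  coordinate with respect to the chart \<open>M\<close>.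
\<close>

definition line_at_infinity :: "complex^3^3 \<Rightarrow> complex^3" where
  "line_at_infinity M = matrix_inv M $ 3"

definition homothety :: "complex \<Rightarrow> complex^3^3" where
  "homothety l = vector [vector [l, 0, 0], vector [0, l, 0], vector [0, 0, 1]]"

definition homogeneous_in_chart :: "complex^3^3 \<Rightarrow> (complex^3 \<Rightarrow> complex^3) \<Rightarrow> bool" where
  "homogeneous_in_chart M \<omega> \<longleftrightarrow>
     (\<forall>l. l \<noteq> 0 \<longrightarrow> same_foliation (pullback M \<omega>) (pullback (homothety l) (pullback M \<omega>)))"

section \<open>Legendre transform\<close>

text \<open>
  A \<open>k\<close>-web on (an open subset of) the affine chart \<open>(p, q)\<close> of the dual plane is given by a
  symmetric \<open>k\<close>-form: a function of the point \<open>(p, q)\<close> and of the tangent vector \<open>(dp, dq)\<close>,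
  homogeneous of degree \<open>k\<close> in the latter. Superposition is multiplication of the forms.
\<close>

type_synonym point = "complex \<times> complex"
type_synonym symmetric_form = "point \<Rightarrow> complex \<times> complex \<Rightarrow> complex"

definition superposition :: "symmetric_form \<Rightarrow> symmetric_form \<Rightarrow> symmetric_form"
  (infixl \<open>\<boxtimes>\<close> 70) where
  "(S \<boxtimes> T) z w = S z w * T z w"

text \<open>
  With \<open>A dx + B dy\<close> the restriction of \<open>\<omega>\<close> to the standard chart \<open>(x, y, 1)\<close>,
  \<open>legendre_poly \<omega> p q\<close> is \<open>A(x, p x - q) + p B(x, p x - q)\<close> as a polynomial in \<open>x\<close>.
  By the Euler relation its degree is at most the degree \<open>d\<close> of the foliation, and the
  equation of the web, with \<open>x = dq/dp\<close>, is cleared of denominators by the factor \<open>dp^d\<close>.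
\<close>

definition legendre_poly :: "(complex^3 \<Rightarrow> complex^3) \<Rightarrow> complex \<Rightarrow> complex \<Rightarrow> complex poly" where
  "legendre_poly \<omega> p q = (THE f. \<forall>x. poly f x =
      \<omega> (vector [x, p * x - q, 1]) $ 1 + p * \<omega> (vector [x, p * x - q, 1]) $ 2)"

definition leg_foliation :: "nat \<Rightarrow> (complex^3 \<Rightarrow> complex^3) \<Rightarrow> symmetric_form" where
  "leg_foliation d \<omega> = (\<lambda>(p, q) (dp, dq).
     \<Sum>i\<le>d. coeff (legendre_poly \<omega> p q) i * dq ^ i * dp ^ (d - i))"

text \<open>
  The line \<open>l1 X + l2 Y + l3 Z = 0\<close> is dual to the point \<open>[l1 : l2 : l3]\<close>, and \<open>(p, q)\<close> is the
  point \<open>[p : -1 : -q]\<close>. The lines of the dual plane through \<open>[l1 : l2 : l3]\<close> are the leaves of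
  the form below, which for \<open>l = (0, 0, 1)\<close> is \<open>dp\<close>.
\<close>

definition leg_line :: "complex^3 \<Rightarrow> symmetric_form" where
  "leg_line l = (\<lambda>(p, q) (dp, dq). (l $ 3 - l $ 2 * q) * dp + (l $ 1 + l $ 2 * p) * dq)"

text \<open>
  The Legendre transform of the pre-foliation given by the pair \<open>(l, \<omega>)\<close>, with \<open>\<omega>\<close> a foliation
  of degree \<open>d\<close>, in the dual chart \<open>(p, q)\<close> associated with the lines \<open>y = p x - q\<close> of the
  affine chart \<open>M\<close>.
\<close>

definition leg_prefoliation ::
  "complex^3^3 \<Rightarrow> nat \<Rightarrow> (complex^3) \<times> (complex^3 \<Rightarrow> complex^3) \<Rightarrow> symmetric_form" where
  "leg_prefoliation M d P =
     leg_line (transpose M *v fst P) \<boxtimes> leg_foliation d (pullback M (snd P))"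

section \<open>Curvature of 3-webs\<close>

text \<open>
  A 1-form is represented by its pair of coefficients, a 2-form by its coefficient
  with respect to the wedge product of the two coordinate differentials.
\<close>

type_synonym one_form = "point \<Rightarrow> complex \<times> complex"

definition holomorphic_fun_on :: "(point \<Rightarrow> complex) \<Rightarrow> point set \<Rightarrow> bool" where
  "holomorphic_fun_on f U \<longleftrightarrow>
     (\<forall>z\<in>U. \<exists>a b. (f has_derivative (\<lambda>h. a * fst h + b * snd h)) (at z))"

definition holomorphic_form_on :: "one_form \<Rightarrow> point set \<Rightarrow> bool" where
  "holomorphic_form_on \<alpha> U \<longleftrightarrow>
     holomorphic_fun_on (\<lambda>z. fst (\<alpha> z)) U \<and> holomorphic_fun_on (\<lambda>z. snd (\<alpha> z)) U"

definition eval_form :: "one_form \<Rightarrow> symmetric_form" where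
  "eval_form \<alpha> z w = fst (\<alpha> z) * fst w + snd (\<alpha> z) * snd w"

definition wedge :: "one_form \<Rightarrow> one_form \<Rightarrow> point \<Rightarrow> complex" where
  "wedge \<alpha> \<beta> z = fst (\<alpha> z) * snd (\<beta> z) - snd (\<alpha> z) * fst (\<beta> z)"

definition scale_form :: "(point \<Rightarrow> complex) \<Rightarrow> one_form \<Rightarrow> one_form" where
  "scale_form g \<alpha> z = (g z * fst (\<alpha> z), g z * snd (\<alpha> z))"

definition ext_deriv :: "one_form \<Rightarrow> point \<Rightarrow> complex" where
  "ext_deriv \<alpha> z =
     deriv (\<lambda>s. snd (\<alpha> (s, snd z))) (fst z) - deriv (\<lambda>s. fst (\<alpha> (fst z, s))) (snd z)"

text \<open>
  On \<open>U\<close> the web \<open>W\<close> is the superposition of the pairwise transverse foliations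
  \<open>\<omega>\<^sub>i = 0\<close>. The factor \<open>h\<close> is there because the forms matter only up to units.
\<close>

definition decomposes_on ::
  "symmetric_form \<Rightarrow> point set \<Rightarrow> one_form \<Rightarrow> one_form \<Rightarrow> one_form \<Rightarrow> bool" where
  "decomposes_on W U \<omega>\<^sub>1 \<omega>\<^sub>2 \<omega>\<^sub>3 \<longleftrightarrow>
     open U \<and>
     holomorphic_form_on \<omega>\<^sub>1 U \<and> holomorphic_form_on \<omega>\<^sub>2 U \<and> holomorphic_form_on \<omega>\<^sub>3 U \<and>
     (\<forall>z\<in>U. wedge \<omega>\<^sub>1 \<omega>\<^sub>2 z \<noteq> 0 \<and> wedge \<omega>\<^sub>2 \<omega>\<^sub>3 z \<noteq> 0 \<and> wedge \<omega>\<^sub>3 \<omega>\<^sub>1 z \<noteq> 0) \<and>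
     (\<exists>h. \<forall>z\<in>U. h z \<noteq> 0 \<and>
        (\<forall>w. W z w = h z * (eval_form \<omega>\<^sub>1 \<boxtimes> eval_form \<omega>\<^sub>2 \<boxtimes> eval_form \<omega>\<^sub>3) z w))"

definition three_web :: "symmetric_form \<Rightarrow> bool" where
  "three_web W \<longleftrightarrow>
     closure {z. \<exists>U \<omega>\<^sub>1 \<omega>\<^sub>2 \<omega>\<^sub>3. z \<in> U \<and> decomposes_on W U \<omega>\<^sub>1 \<omega>\<^sub>2 \<omega>\<^sub>3} = UNIV"

definition web_connection ::
  "point set \<Rightarrow> one_form \<Rightarrow> one_form \<Rightarrow> one_form \<Rightarrow> one_form \<Rightarrow> bool" where
  "web_connection U \<omega>\<^sub>1 \<omega>\<^sub>2 \<omega>\<^sub>3 \<eta> \<longleftrightarrow>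
     holomorphic_form_on \<eta> U \<and>
     (let \<theta>\<^sub>1 = scale_form (wedge \<omega>\<^sub>2 \<omega>\<^sub>3) \<omega>\<^sub>1;
          \<theta>\<^sub>2 = scale_form (wedge \<omega>\<^sub>3 \<omega>\<^sub>1) \<omega>\<^sub>2;
          \<theta>\<^sub>3 = scale_form (wedge \<omega>\<^sub>1 \<omega>\<^sub>2) \<omega>\<^sub>3
      in \<forall>z\<in>U. ext_deriv \<theta>\<^sub>1 z = wedge \<eta> \<theta>\<^sub>1 z \<and>
               ext_deriv \<theta>\<^sub>2 z = wedge \<eta> \<theta>\<^sub>2 z \<and>
               ext_deriv \<theta>\<^sub>3 z = wedge \<eta> \<theta>\<^sub>3 z)"

definition has_curvature ::
  "point set \<Rightarrow> one_form \<Rightarrow> one_form \<Rightarrow> one_form \<Rightarrow> (point \<Rightarrow> complex) \<Rightarrow> bool" where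
  "has_curvature U \<omega>\<^sub>1 \<omega>\<^sub>2 \<omega>\<^sub>3 K \<longleftrightarrow>
     (\<exists>\<eta>. web_connection U \<omega>\<^sub>1 \<omega>\<^sub>2 \<omega>\<^sub>3 \<eta> \<and> (\<forall>z\<in>U. K z = ext_deriv \<eta> z))"

text \<open>
  The curvature is a meromorphic 2-form on the connected dual plane, so it vanishes
  identically iff it vanishes wherever the web decomposes in the chart \<open>(p, q)\<close>.
\<close>

definition flat_web :: "symmetric_form \<Rightarrow> bool" where
  "flat_web W \<longleftrightarrow>
     three_web W \<and>
     (\<forall>U \<omega>\<^sub>1 \<omega>\<^sub>2 \<omega>\<^sub>3. decomposes_on W U \<omega>\<^sub>1 \<omega>\<^sub>2 \<omega>\<^sub>3 \<longrightarrow> has_curvature U \<omega>\<^sub>1 \<omega>\<^sub>2 \<omega>\<^sub>3 (\<lambda>z. 0))"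

end

theory Submission
  imports Defs
begin

text \<open>
  Bihomogeneity and the Euler relation bring a homogeneous foliation of degree 2 to the form
  \<open>A Z dX + B Z dY - (X A + Y B) dZ\<close> with coprime binary quadratic forms \<open>A\<close>, \<open>B\<close>. The dual web is
  then \<open>dp \<cdot> (P(p) dq\<^sup>2 - q R(p) dq dp + q\<^sup>2 S(p) dp\<^sup>2)\<close>, which is invariant under \<open>q \<mapsto> l q\<close>: its leaves
  are those of \<open>dp\<close> and of the two closed forms \<open>dq/q - \<sigma>(p) dp\<close>, where \<open>\<sigma>\<close> is a root of
  \<open>P \<sigma>\<^sup>2 - R \<sigma> + S\<close>. Normalised to sum to zero, the three forms are a common multiple \<open>G\<close> of
  closed forms, so the connection form is \<open>dG/G\<close>, which is closed. Coprimality of \<open>A\<close> and \<open>B\<close> makes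
  \<open>P\<close> and the discriminant \<open>R\<^sup>2 - 4 P S\<close> nonzero, so that this is indeed a 3-web.
\<close>

unbundle no Formal_Power_Series.fps_syntax

section \<open>Holomorphic functions of two variables\<close>

text \<open>The obstacle is that flatness is tested on every decomposition of the web over every
  open set. The three forms come with arbitrary holomorphic units and in arbitrary order, the set
  need not be connected, and the form proportional to dp may be a different one on different
  components. Hence \<open>G\<close> is a symmetric expression in the coefficients of the given
  forms instead of being built from chosen roots \<sigma>, and the structure equations are checked
  point by point. Independence of \<sigma> from q comes from differentiating the quadratic equation;
  its roots are simple because the forms are transverse. Explicit square roots occur only where a
  decomposition has to be exhibited. Closedness of dG/G requires commuting mixed partials, while
  holomorphy is defined as complex differentiability at each point; the regularity of the partials
  is drawn from Weierstrass convergence in one variable. On the side of the foliation, invariance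
  supplies an unknown factor for each ratio l. Evaluation at one point shows that it is a power l^n,
  and coprimality forces n = 3, the weight of A Z dX.\<close>

definition partial1 :: "(point \<Rightarrow> complex) \<Rightarrow> point \<Rightarrow> complex" where
  "partial1 f z = deriv (\<lambda>s. f (s, snd z)) (fst z)"

definition partial2 :: "(point \<Rightarrow> complex) \<Rightarrow> point \<Rightarrow> complex" where
  "partial2 f z = deriv (\<lambda>s. f (fst z, s)) (snd z)"

lemma holomorphic_fun_onD:
  assumes "holomorphic_fun_on f U" "z \<in> U"
  shows "((\<lambda>s. f (s, snd z)) has_field_derivative partial1 f z) (at (fst z))"
    and "((\<lambda>s. f (fst z, s)) has_field_derivative partial2 f z) (at (snd z))"
    and "(f has_derivative (\<lambda>h. partial1 f z * fst h + partial2 f z * snd h)) (at z)"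
proof -
  obtain a b where d: "(f has_derivative (\<lambda>h. a * fst h + b * snd h)) (at z)"
    using assms unfolding holomorphic_fun_on_def by blast
  have "((\<lambda>s. (s, snd z)) has_derivative (\<lambda>h. (h, 0))) (at (fst z))"
    by (auto intro!: derivative_eq_intros)
  then have "((\<lambda>s. f (s, snd z)) has_derivative (\<lambda>h. a * h)) (at (fst z))"
    using has_derivative_compose[of "\<lambda>s. (s, snd z)" _ "fst z" UNIV f] d by fastforce
  then have 1: "((\<lambda>s. f (s, snd z)) has_field_derivative a) (at (fst z))"
    by (simp add: has_field_derivative_def)
  have "((\<lambda>s. (fst z, s)) has_derivative (\<lambda>h. (0, h))) (at (snd z))"
    by (auto intro!: derivative_eq_intros)
  then have "((\<lambda>s. f (fst z, s)) has_derivative (\<lambda>h. b * h)) (at (snd z))"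
    using has_derivative_compose[of "\<lambda>s. (fst z, s)" _ "snd z" UNIV f] d by fastforce
  then have 2: "((\<lambda>s. f (fst z, s)) has_field_derivative b) (at (snd z))"
    by (simp add: has_field_derivative_def)
  have ab: "a = partial1 f z" "b = partial2 f z"
    using 1 2 by (auto simp: partial1_def partial2_def dest: DERIV_imp_deriv)
  show "((\<lambda>s. f (s, snd z)) has_field_derivative partial1 f z) (at (fst z))"
    "((\<lambda>s. f (fst z, s)) has_field_derivative partial2 f z) (at (snd z))"
    "(f has_derivative (\<lambda>h. partial1 f z * fst h + partial2 f z * snd h)) (at z)"
    using 1 2 d ab by simp_all
qed

section \<open>Closure properties of holomorphic functions of two variables\<close>

lemma holomorphic_fun_on_subset: "holomorphic_fun_on f U \<Longrightarrow> V \<subseteq> U \<Longrightarrow> holomorphic_fun_on f V"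
  by (auto simp: holomorphic_fun_on_def)

lemma holomorphic_fun_on_imp_continuous_on:
  assumes "holomorphic_fun_on f U" shows "continuous_on U f"
  by (blast intro: continuous_at_imp_continuous_on has_derivative_continuous holomorphic_fun_onD(3)[OF assms])

lemma holomorphic_fun_on_const: "holomorphic_fun_on (\<lambda>z. c) U"
  unfolding holomorphic_fun_on_def by (auto intro!: exI[of _ 0])

lemma holomorphic_fun_on_snd: "holomorphic_fun_on snd U"
  unfolding holomorphic_fun_on_def
  by (intro ballI exI[of _ 0] exI[of _ 1]) (auto intro!: derivative_eq_intros)

lemma holomorphic_fun_on_compose_fst:
  assumes "\<And>z. z \<in> U \<Longrightarrow> f field_differentiable (at (fst z))"
  shows "holomorphic_fun_on (\<lambda>z. f (fst z)) U"
  unfolding holomorphic_fun_on_def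
proof
  fix z assume "z \<in> U"
  then obtain a where "(f has_derivative (\<lambda>h. a * h)) (at (fst z))"
    using assms unfolding field_differentiable_def has_field_derivative_def by blast
  then have "((\<lambda>z. f (fst z)) has_derivative (\<lambda>h. a * fst h + 0 * snd h)) (at z)"
    using has_derivative_compose[OF has_derivative_fst[OF has_derivative_ident]] by fastforce
  then show "\<exists>a b. ((\<lambda>z. f (fst z)) has_derivative (\<lambda>h. a * fst h + b * snd h)) (at z)" by blast
qed

lemma holomorphic_fun_on_add:
  assumes "holomorphic_fun_on f U" "holomorphic_fun_on g U"
  shows "holomorphic_fun_on (\<lambda>z. f z + g z) U"
  unfolding holomorphic_fun_on_def
proof
  fix z assume z: "z \<in> U"
  show "\<exists>a b. ((\<lambda>z. f z + g z) has_derivative (\<lambda>h. a * fst h + b * snd h)) (at z)"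
    by (rule exI[of _ "partial1 f z + partial1 g z"], rule exI[of _ "partial2 f z + partial2 g z"])
      (rule has_derivative_eq_rhs[OF has_derivative_add[OF holomorphic_fun_onD(3)[OF assms(1) z]
          holomorphic_fun_onD(3)[OF assms(2) z]]], simp add: fun_eq_iff algebra_simps)
qed

lemma holomorphic_fun_on_mult:
  assumes "holomorphic_fun_on f U" "holomorphic_fun_on g U"
  shows "holomorphic_fun_on (\<lambda>z. f z * g z) U"
  unfolding holomorphic_fun_on_def
proof
  fix z assume z: "z \<in> U"
  show "\<exists>a b. ((\<lambda>z. f z * g z) has_derivative (\<lambda>h. a * fst h + b * snd h)) (at z)"
    by (rule exI[of _ "f z * partial1 g z + partial1 f z * g z"],
        rule exI[of _ "f z * partial2 g z + partial2 f z * g z"])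
      (rule has_derivative_eq_rhs[OF has_derivative_mult[OF holomorphic_fun_onD(3)[OF assms(1) z]
          holomorphic_fun_onD(3)[OF assms(2) z]]], simp add: fun_eq_iff algebra_simps)
qed

lemma holomorphic_fun_on_inverse:
  assumes "holomorphic_fun_on f U" "\<And>z. z \<in> U \<Longrightarrow> f z \<noteq> 0"
  shows "holomorphic_fun_on (\<lambda>z. inverse (f z)) U"
  unfolding holomorphic_fun_on_def
proof
  fix z assume z: "z \<in> U"
  show "\<exists>a b. ((\<lambda>z. inverse (f z)) has_derivative (\<lambda>h. a * fst h + b * snd h)) (at z)"
    by (rule exI[of _ "- (inverse (f z) * partial1 f z * inverse (f z))"],
        rule exI[of _ "- (inverse (f z) * partial2 f z * inverse (f z))"])
      (rule has_derivative_eq_rhs[OF Deriv.has_derivative_inverse[OF assms(2)[OF z]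
          holomorphic_fun_onD(3)[OF assms(1) z]]], simp add: fun_eq_iff algebra_simps)
qed

lemma holomorphic_fun_on_uminus:
  assumes "holomorphic_fun_on f U"
  shows "holomorphic_fun_on (\<lambda>z. - f z) U"
  using holomorphic_fun_on_mult[OF holomorphic_fun_on_const[of "-1"] assms] by simp

lemma holomorphic_fun_on_divide:
  assumes "holomorphic_fun_on f U" "holomorphic_fun_on g U" "\<And>z. z \<in> U \<Longrightarrow> g z \<noteq> 0"
  shows "holomorphic_fun_on (\<lambda>z. f z / g z) U"
  using holomorphic_fun_on_mult[OF assms(1) holomorphic_fun_on_inverse[OF assms(2,3)]]
  by (simp add: divide_inverse)

lemmas holomorphic_fun_on_intros = holomorphic_fun_on_const holomorphic_fun_on_snd
  holomorphic_fun_on_add holomorphic_fun_on_mult holomorphic_fun_on_uminus holomorphic_fun_on_divide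

section \<open>Regularity and symmetry of the partial derivatives\<close>

lemma mem_ball_vertical:
  fixes z z0 :: point
  assumes "dist z z0 < r" "norm t \<le> r"
  shows "(fst z, snd z + t) \<in> cball z0 (2 * r)"
proof -
  have "dist (fst z, snd z + t) z \<le> r"
    using assms(2) by (cases z) (simp add: dist_Pair_Pair dist_norm)
  with assms(1) show ?thesis
    using dist_triangle[of "(fst z, snd z + t)" z0 z] by (simp add: dist_commute)
qed

text \<open>As \<open>z\<close> tends to \<open>z0\<close>, the vertical slices of \<open>f\<close>
  through \<open>z\<close> converge uniformly on a disc to the slice through \<open>z0\<close>. The
  slices are holomorphic in one variable, so by Weierstrass their derivatives converge too.\<close>

lemma continuous_on_partial2:
  assumes U: "open U" and cont: "continuous_on U f"
    and diff: "\<And>z. z \<in> U \<Longrightarrow> (\<lambda>s. f (fst z, s)) field_differentiable (at (snd z))"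
  shows "continuous_on U (partial2 f)"
proof (rule continuous_at_imp_continuous_on, rule ballI)
  fix z0 assume z0: "z0 \<in> U"
  obtain e where e: "e > 0" "cball z0 e \<subseteq> U"
    using U z0 open_contains_cball by blast
  define r where "r = e / 2"
  have r: "r > 0" "cball z0 (2 * r) \<subseteq> U" using e by (auto simp: r_def)
  have uc: "uniformly_continuous_on (cball z0 (2 * r)) f"
    using cont r(2) by (intro compact_uniformly_continuous) (auto intro: continuous_on_subset)
  have near: "\<forall>\<^sub>F z in at z0. dist z z0 < r"
    using r(1) eventually_at by blast
  have ul: "uniform_limit (cball 0 r) (\<lambda>z t. f (fst z, snd z + t))
      (\<lambda>t. f (fst z0, snd z0 + t)) (at z0)"
    unfolding uniform_limit_iff
  proof (intro allI impI)
    fix \<epsilon> :: real assume "\<epsilon> > 0"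
    then obtain d where d: "d > 0"
      "\<And>x y. x \<in> cball z0 (2 * r) \<Longrightarrow> y \<in> cball z0 (2 * r) \<Longrightarrow> dist y x < d \<Longrightarrow> dist (f y) (f x) < \<epsilon>"
      using uc unfolding uniformly_continuous_on_def by meson
    have "\<forall>\<^sub>F z in at z0. dist z z0 < d" using d(1) eventually_at by blast
    with near show "\<forall>\<^sub>F z in at z0. \<forall>t\<in>cball 0 r.
        dist (f (fst z, snd z + t)) (f (fst z0, snd z0 + t)) < \<epsilon>"
    proof eventually_elim
      case (elim z)
      show ?case
      proof
        fix t :: complex assume "t \<in> cball 0 r"
        then have t: "norm t \<le> r" by simp
        have "dist (fst z, snd z + t) (fst z0, snd z0 + t) = dist z z0"
          by (cases z; cases z0) (simp add: dist_Pair_Pair)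
        then show "dist (f (fst z, snd z + t)) (f (fst z0, snd z0 + t)) < \<epsilon>"
          using mem_ball_vertical[OF elim(1) t] mem_ball_vertical[of z0 z0, OF _ t] r(1) elim(2)
          by (intro d(2)) auto
      qed
    qed
  qed
  have der: "((\<lambda>t. f (fst z, snd z + t)) has_field_derivative partial2 f (fst z, snd z + t)) (at t)"
    if "(fst z, snd z + t) \<in> U" for z t
    using diff[OF that] DERIV_shift[of "\<lambda>s. f (fst z, s)" _ t "snd z"]
    by (simp add: partial2_def DERIV_deriv_iff_field_differentiable[symmetric] add.commute)
  have "\<forall>\<^sub>F z in at z0. continuous_on (cball 0 r) (\<lambda>t. f (fst z, snd z + t)) \<and>
      (\<forall>w\<in>ball 0 r. ((\<lambda>t. f (fst z, snd z + t)) has_field_derivative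
        partial2 f (fst z, snd z + w)) (at w))"
    using near
  proof eventually_elim
    case (elim z)
    have *: "(fst z, snd z + t) \<in> U" if "norm t \<le> r" for t
      using mem_ball_vertical[OF elim that] r(2) by blast
    show ?case
      by (intro conjI ballI continuous_at_imp_continuous_on DERIV_isCont) (auto intro!: der *)
  qed
  from has_complex_derivative_uniform_limit[OF this ul trivial_limit_at r(1)]
  obtain G where G: "\<And>w. w \<in> ball 0 r \<Longrightarrow> ((\<lambda>t. f (fst z0, snd z0 + t)) has_field_derivative G w) (at w) \<and>
      ((\<lambda>z. partial2 f (fst z, snd z + w)) \<longlongrightarrow> G w) (at z0)"
    by blast
  define g' where "g' = G 0"
  have g': "((\<lambda>t. f (fst z0, snd z0 + t)) has_field_derivative g') (at 0)"
      "((\<lambda>z. partial2 f (fst z, snd z + 0)) \<longlongrightarrow> g') (at z0)"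
    using G[of 0] r(1) by (simp_all add: g'_def)
  from g'(1) have "g' = partial2 f z0"
    using DERIV_unique der[of z0 0] z0 by auto
  with g'(2) show "isCont (partial2 f) z0" by (simp add: isCont_def)
qed

lemma continuous_on_partial1:
  assumes U: "open U" and cont: "continuous_on U f"
    and diff: "\<And>z. z \<in> U \<Longrightarrow> (\<lambda>s. f (s, snd z)) field_differentiable (at (fst z))"
  shows "continuous_on U (partial1 f)"
proof -
  let ?g = "\<lambda>z. f (prod.swap z)"
  have "continuous_on (prod.swap -` U) (partial2 ?g)"
  proof (rule continuous_on_partial2)
    show "open (prod.swap -` U)"
      by (rule open_vimage[OF U]) (intro continuous_intros continuous_on_swap)
    show "continuous_on (prod.swap -` U) ?g"
      by (rule continuous_on_compose2[OF cont continuous_on_swap]) auto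
  qed (use diff in auto)
  then have "continuous_on U (\<lambda>z. partial2 ?g (prod.swap z))"
    by (rule continuous_on_compose2[OF _ continuous_on_swap]) auto
  then show ?thesis by (simp add: partial1_def[abs_def] partial2_def)
qed

text \<open>The difference quotients of \<open>f\<close> in the first variable, seen as functions of
  the second, converge uniformly on a disc to \<open>partial1 f\<close>. Weierstrass then gives both
  claims at once: the limit is holomorphic in the second variable, and its derivative is the limit
  of the difference quotients of \<open>partial2 f\<close>.\<close>

lemma partial1_partial2:
  assumes U: "open U" and f: "holomorphic_fun_on f U" and z: "z \<in> U"
  shows "(\<lambda>s. partial1 f (fst z, s)) field_differentiable (at (snd z))"
    and "((\<lambda>s. partial2 f (s, snd z)) has_field_derivative partial2 (partial1 f) z) (at (fst z))"
proof -
  obtain p q where zpq: "z = (p, q)" by (cases z)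
  obtain e where e: "e > 0" "cball z e \<subseteq> U"
    using U z open_contains_cball by blast
  define r where "r = e / 2"
  have r: "r > 0" "cball z (2 * r) \<subseteq> U" using e by (auto simp: r_def)
  have inK: "(p + h, q + t) \<in> cball z (2 * r)" if "norm h < r" "norm t \<le> r" for h t
    using mem_ball_vertical[of "(p + h, q)" z r t] that
    by (auto simp: zpq dist_Pair_Pair dist_norm)
  have "continuous_on U (partial1 f)"
    by (rule continuous_on_partial1[OF U holomorphic_fun_on_imp_continuous_on[OF f]])
      (use holomorphic_fun_onD(1)[OF f] field_differentiable_def in blast)
  then have uc: "uniformly_continuous_on (cball z (2 * r)) (partial1 f)"
    using r(2) by (intro compact_uniformly_continuous) (auto intro: continuous_on_subset)
  have d1: "((\<lambda>s. f (s, y)) has_field_derivative partial1 f (x, y)) (at x)" if "(x, y) \<in> U" for x y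
    using holomorphic_fun_onD(1)[OF f that] by simp
  have d2: "((\<lambda>t. f (x, q + t)) has_field_derivative partial2 f (x, q + t)) (at t)"
    if "(x, q + t) \<in> U" for x t
    using holomorphic_fun_onD(2)[OF f that] DERIV_shift[of "\<lambda>s. f (x, s)" _ t q]
    by (simp add: add.commute)
  let ?Q = "\<lambda>h t. (f (p + h, q + t) - f (p, q + t)) / h"
  have near: "\<forall>\<^sub>F h in at 0. norm h < r \<and> h \<noteq> (0::complex)"
    using r(1) by (auto simp: eventually_at intro!: exI[of _ r])
  have ul: "uniform_limit (cball 0 r) ?Q (\<lambda>t. partial1 f (p, q + t)) (at 0)"
    unfolding uniform_limit_iff
  proof (intro allI impI)
    fix \<epsilon> :: real assume eps: "\<epsilon> > 0"
    then obtain d where d: "d > 0"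
      "\<And>x y. x \<in> cball z (2 * r) \<Longrightarrow> y \<in> cball z (2 * r) \<Longrightarrow> dist y x < d \<Longrightarrow>
        dist (partial1 f y) (partial1 f x) < \<epsilon> / 2"
      using uc unfolding uniformly_continuous_on_def by (meson half_gt_zero)
    have "\<forall>\<^sub>F h in at 0. norm (h::complex) < d" using d(1) by (auto simp: eventually_at)
    with near show "\<forall>\<^sub>F h in at 0. \<forall>t\<in>cball 0 r. dist (?Q h t) (partial1 f (p, q + t)) < \<epsilon>"
    proof eventually_elim
      case (elim h)
      show ?case
      proof
        fix t :: complex assume "t \<in> cball 0 r"
        then have t: "norm t \<le> r" by simp
        define c where "c = partial1 f (p, q + t)"
        define m where "m = min r d"
        \<comment> \<open>Subtracting the linear function of slope \<open>c\<close> turns the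
          uniform estimate into the mean value inequality on a ball where \<open>partial1 f\<close>
          stays within \<epsilon> / 2 of \<open>c\<close>.\<close>
        have "norm ((f (p + h, q + t) - c * (p + h)) - (f (p, q + t) - c * p)) \<le> (\<epsilon> / 2) * norm ((p + h) - p)"
        proof (rule field_differentiable_bound[where S = "ball p m" and f' = "\<lambda>x. partial1 f (x, q + t) - c"])
          fix x assume "x \<in> ball p m"
          then have x: "norm (x - p) < r" "norm (x - p) < d"
            by (auto simp: m_def dist_norm norm_minus_commute)
          have K: "(x, q + t) \<in> cball z (2 * r)" "(p, q + t) \<in> cball z (2 * r)"
            using inK[OF x(1) t] inK[of 0, OF _ t] r(1) by auto
          show "((\<lambda>x. f (x, q + t) - c * x) has_field_derivative partial1 f (x, q + t) - c) (at x within ball p m)"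
            using K(1) r(2) by (intro has_field_derivative_at_within[OF DERIV_diff[OF d1 DERIV_cmult_Id]]) blast
          show "norm (partial1 f (x, q + t) - c) \<le> \<epsilon> / 2"
            using d(2)[OF K(2) K(1)] x(2) by (simp add: dist_Pair_Pair c_def dist_norm)
        qed (use elim d(1) r(1) in \<open>auto simp: m_def dist_norm\<close>)
        then have "norm (f (p + h, q + t) - f (p, q + t) - c * h) \<le> (\<epsilon> / 2) * norm h"
          by (simp add: algebra_simps)
        moreover have "?Q h t - c = (f (p + h, q + t) - f (p, q + t) - c * h) / h"
          using elim by (simp add: field_simps)
        ultimately have "norm (?Q h t - c) \<le> \<epsilon> / 2"
          using elim by (simp add: norm_divide divide_le_eq)
        then show "dist (?Q h t) (partial1 f (p, q + t)) < \<epsilon>"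
          using eps by (simp add: dist_norm c_def)
      qed
    qed
  qed
  have "\<forall>\<^sub>F h in at 0. continuous_on (cball 0 r) (?Q h) \<and> (\<forall>w\<in>ball 0 r. (?Q h has_field_derivative
        (partial2 f (p + h, q + w) - partial2 f (p, q + w)) / h) (at w))"
    using near
  proof eventually_elim
    case (elim h)
    have *: "(?Q h has_field_derivative (partial2 f (p + h, q + w) - partial2 f (p, q + w)) / h) (at w)"
      if w: "norm w \<le> r" for w
    proof -
      have "(p + h, q + w) \<in> U" "(p, q + w) \<in> U"
        using elim inK[OF _ w] inK[OF _ w, of 0] r by auto
      then show ?thesis by (intro DERIV_cdivide DERIV_diff d2)
    qed
    show ?case
      by (intro conjI ballI continuous_at_imp_continuous_on DERIV_isCont) (auto intro!: *)
  qed
  from has_complex_derivative_uniform_limit[OF this ul trivial_limit_at r(1)]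
  obtain G where G: "\<And>w. w \<in> ball 0 r \<Longrightarrow> ((\<lambda>t. partial1 f (p, q + t)) has_field_derivative G w) (at w) \<and>
      ((\<lambda>h. (partial2 f (p + h, q + w) - partial2 f (p, q + w)) / h) \<longlongrightarrow> G w) (at 0)"
    by blast
  define g' where "g' = G 0"
  have g': "((\<lambda>t. partial1 f (p, q + t)) has_field_derivative g') (at 0)"
      "((\<lambda>h. (partial2 f (p + h, q) - partial2 f (p, q)) / h) \<longlongrightarrow> g') (at 0)"
    using G[of 0] r(1) by (simp_all add: g'_def)
  have D: "((\<lambda>s. partial1 f (p, s)) has_field_derivative g') (at q)"
    using g'(1) DERIV_shift[of "\<lambda>s. partial1 f (p, s)" g' 0 q] by (simp add: add.commute)
  then have "g' = partial2 (partial1 f) z"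
    unfolding partial2_def[of "partial1 f"] zpq using DERIV_imp_deriv by fastforce
  with g'(2) show "((\<lambda>s. partial2 f (s, snd z)) has_field_derivative partial2 (partial1 f) z) (at (fst z))"
    by (simp add: DERIV_def zpq)
  show "(\<lambda>s. partial1 f (fst z, s)) field_differentiable (at (snd z))"
    using D by (auto simp: zpq field_differentiable_def)
qed

lemma partial1_partial2_commute:
  assumes "open U" "holomorphic_fun_on f U" "z \<in> U"
  shows "partial1 (partial2 f) z = partial2 (partial1 f) z"
  unfolding partial1_def[of "partial2 f"] by (rule DERIV_imp_deriv[OF partial1_partial2(2)[OF assms]])

text \<open>Total differentiability of \<open>partial2 f\<close> follows from its own two partials:
  the one in the first variable exists by the interchange of limits, and the one in the second is
  continuous, being a second derivative along slices.\<close>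

lemma holomorphic_fun_on_partial2:
  assumes U: "open U" and f: "holomorphic_fun_on f U"
  shows "holomorphic_fun_on (partial2 f) U"
  unfolding holomorphic_fun_on_def
proof
  fix z assume z: "z \<in> U"
  obtain p q where zpq: "z = (p, q)" by (cases z)
  have fd: "(\<lambda>s. f (fst z, s)) field_differentiable (at (snd z))" if "z \<in> U" for z
    using holomorphic_fun_onD(2)[OF f that] field_differentiable_def by blast
  have c2: "continuous_on U (partial2 f)"
    by (rule continuous_on_partial2[OF U holomorphic_fun_on_imp_continuous_on[OF f] fd])
  have d22: "(\<lambda>s. partial2 f (fst z, s)) field_differentiable (at (snd z))" if "z \<in> U" for z
  proof -
    let ?V = "{s. (fst z, s) \<in> U}"
    have V: "open ?V"
      using open_vimage[OF U, of "\<lambda>s. (fst z, s)"] by (simp add: vimage_def continuous_on_Pair)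
    have "(\<lambda>s. f (fst z, s)) holomorphic_on ?V"
      unfolding holomorphic_on_def using fd by (auto intro: field_differentiable_at_within)
    then have "deriv (\<lambda>s. f (fst z, s)) holomorphic_on ?V" using V by (rule holomorphic_deriv)
    then show ?thesis
      using that V by (auto simp: partial2_def holomorphic_on_def at_within_open[OF _ V])
  qed
  have c22: "continuous_on U (partial2 (partial2 f))"
    by (rule continuous_on_partial2[OF U c2 d22])
  obtain A B where AB: "open A" "open B" "p \<in> A" "q \<in> B" "A \<times> B \<subseteq> U"
    using U z zpq by (metis open_prod_elim mem_Sigma_iff)
  \<comment> \<open>The second factor is shrunk to a ball because the criterion by partial
    derivatives asks for a convex set there.\<close>
  obtain e where e: "e > 0" "ball q e \<subseteq> B" using AB openE by blast
  have sub: "A \<times> ball q e \<subseteq> U" using AB e by auto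
  let ?fy = "\<lambda>x y. blinfun_mult_right (partial2 (partial2 f) (x, y))"
  have "((\<lambda>(x, y). partial2 f (x, y)) has_derivative
     (\<lambda>(tx, ty). partial2 (partial1 f) z * tx + ?fy p q ty)) (at (p, q) within A \<times> ball q e)"
  proof (rule has_derivative_partialsI)
    show "((\<lambda>x. partial2 f (x, q)) has_derivative (*) (partial2 (partial1 f) z)) (at p within A)"
      using partial1_partial2(2)[OF U f z] has_derivative_at_withinI
      by (auto simp: zpq has_field_derivative_def)
    show "((\<lambda>y. partial2 f (x, y)) has_derivative blinfun_apply (?fy x y)) (at y within ball q e)"
      if "x \<in> A" "y \<in> ball q e" for x y
    proof -
      have "(x, y) \<in> U" using that sub by auto
      from d22[OF this] have "((\<lambda>s. partial2 f (x, s)) has_field_derivative partial2 (partial2 f) (x, y)) (at y)"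
        by (simp add: partial2_def[of "partial2 f"] DERIV_deriv_iff_field_differentiable)
      then show ?thesis unfolding has_field_derivative_def by (simp add: has_derivative_at_withinI)
    qed
    have "continuous_on (A \<times> ball q e) (\<lambda>z. blinfun_mult_right (partial2 (partial2 f) z))"
      by (intro continuous_intros continuous_on_subset[OF c22 sub])
    then show "continuous (at (p, q) within A \<times> ball q e) (\<lambda>(x, y). ?fy x y)"
      using AB e by (auto simp: case_prod_unfold continuous_on_eq_continuous_within)
  qed (use AB e in auto)
  moreover have "at (p, q) within A \<times> ball q e = at (p, q)"
    using AB e by (intro at_within_open) (auto intro: open_Times)
  ultimately have "(partial2 f has_derivative
      (\<lambda>h. partial2 (partial1 f) z * fst h + partial2 (partial2 f) z * snd h)) (at z)"
    by (simp add: zpq case_prod_unfold)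
  then show "\<exists>a b. (partial2 f has_derivative (\<lambda>h. a * fst h + b * snd h)) (at z)" by blast
qed

lemma holomorphic_fun_on_swap:
  assumes "holomorphic_fun_on f U"
  shows "holomorphic_fun_on (\<lambda>z. f (prod.swap z)) (prod.swap -` U)"
  unfolding holomorphic_fun_on_def
proof
  fix z assume "z \<in> prod.swap -` U"
  then obtain a b where "(f has_derivative (\<lambda>h. a * fst h + b * snd h)) (at (prod.swap z))"
    using assms unfolding holomorphic_fun_on_def by auto
  moreover have "(prod.swap has_derivative prod.swap) (at z)"
    unfolding prod.swap_def[abs_def] by (auto intro!: derivative_eq_intros)
  ultimately have "((\<lambda>z. f (prod.swap z)) has_derivative (\<lambda>h. b * fst h + a * snd h)) (at z)"
    using has_derivative_compose[of prod.swap prod.swap z UNIV f] by (fastforce simp: add.commute)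
  then show "\<exists>a b. ((\<lambda>z. f (prod.swap z)) has_derivative (\<lambda>h. a * fst h + b * snd h)) (at z)" by blast
qed

lemma holomorphic_fun_on_partial1:
  assumes U: "open U" and f: "holomorphic_fun_on f U"
  shows "holomorphic_fun_on (partial1 f) U"
proof -
  have "open (prod.swap -` U)"
    by (rule open_vimage[OF U]) (intro continuous_intros continuous_on_swap)
  from holomorphic_fun_on_swap[OF holomorphic_fun_on_partial2[OF this holomorphic_fun_on_swap[OF f]]]
  show ?thesis by (simp add: partial1_def[abs_def] partial2_def vimage_comp[symmetric] comp_def vimage_def)
qed

section \<open>The connection form of the dual web\<close>

lemma eventually_slices:
  fixes V :: "point set"
  assumes "open V" "z \<in> V"
  shows "\<forall>\<^sub>F s in nhds (fst z). (s, snd z) \<in> V" "\<forall>\<^sub>F s in nhds (snd z). (fst z, s) \<in> V"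
proof -
  have "\<forall>\<^sub>F s in nhds z. s \<in> V" using assms by (rule eventually_nhds_in_open)
  moreover have "filterlim (\<lambda>s. (s, snd z)) (nhds z) (nhds (fst z))"
    "filterlim (\<lambda>s. (fst z, s)) (nhds z) (nhds (snd z))"
    using tendsto_Pair[OF filterlim_ident[of "nhds (fst z)"] tendsto_const[of "snd z"]]
      tendsto_Pair[OF tendsto_const[of "fst z"] filterlim_ident[of "nhds (snd z)"]] by auto
  ultimately show "\<forall>\<^sub>F s in nhds (fst z). (s, snd z) \<in> V" "\<forall>\<^sub>F s in nhds (snd z). (fst z, s) \<in> V"
    by (auto dest: filterlim_iff[THEN iffD1])
qed

definition dlog :: "(point \<Rightarrow> complex) \<Rightarrow> one_form" where
  "dlog G z = (partial1 G z / G z, partial2 G z / G z)"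

lemma holomorphic_form_on_dlog:
  assumes "open U" "holomorphic_fun_on G U" "\<And>z. z \<in> U \<Longrightarrow> G z \<noteq> 0"
  shows "holomorphic_form_on (dlog G) U"
  using assms holomorphic_fun_on_partial1 holomorphic_fun_on_partial2
  by (auto simp: holomorphic_form_on_def dlog_def intro!: holomorphic_fun_on_divide)

lemma ext_deriv_dlog:
  assumes U: "open U" and G: "holomorphic_fun_on G U" and z: "z \<in> U" and nz: "G z \<noteq> 0"
  shows "ext_deriv (dlog G) z = 0"
proof -
  have 1: "((\<lambda>s. partial2 G (s, snd z) / G (s, snd z)) has_field_derivative
      (partial1 (partial2 G) z * G z - partial2 G z * partial1 G z) / (G z * G z)) (at (fst z))"
    using DERIV_divide[OF holomorphic_fun_onD(1)[OF holomorphic_fun_on_partial2[OF U G] z]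
      holomorphic_fun_onD(1)[OF G z]] nz by simp
  have 2: "((\<lambda>s. partial1 G (fst z, s) / G (fst z, s)) has_field_derivative
      (partial2 (partial1 G) z * G z - partial1 G z * partial2 G z) / (G z * G z)) (at (snd z))"
    using DERIV_divide[OF holomorphic_fun_onD(2)[OF holomorphic_fun_on_partial1[OF U G] z]
      holomorphic_fun_onD(2)[OF G z]] nz by simp
  show ?thesis
    unfolding ext_deriv_def dlog_def
    using DERIV_imp_deriv[OF 1] DERIV_imp_deriv[OF 2] partial1_partial2_commute[OF U G z]
    by (simp add: mult.commute)
qed

text \<open>
  Away from \<open>q = 0\<close> the form \<open>\<alpha> dp + c dq / q\<close> is closed when \<open>\<alpha>\<close> does not depend on \<open>q\<close>.
\<close>

lemma ext_deriv_multiple_of_closed: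
  assumes V: "open V" "z \<in> V" and G: "holomorphic_fun_on G V" and nz: "G z \<noteq> 0" "snd z \<noteq> 0"
    and \<alpha>: "((\<lambda>s. \<alpha> (fst z, s)) has_field_derivative 0) (at (snd z))"
    and \<theta>: "\<And>y. y \<in> V \<Longrightarrow> \<theta> y = (G y * \<alpha> y, G y * c / snd y)"
  shows "ext_deriv \<theta> z = wedge (dlog G) \<theta> z"
proof -
  have d1: "((\<lambda>s. G (s, snd z) * c / snd z) has_field_derivative partial1 G z * c / snd z) (at (fst z))"
    by (intro DERIV_cdivide DERIV_cmult_right holomorphic_fun_onD(1)[OF G V(2)])
  have e1: "\<forall>\<^sub>F s in nhds (fst z). snd (\<theta> (s, snd z)) = G (s, snd z) * c / snd z"
    using eventually_slices(1)[OF V] by eventually_elim (simp add: \<theta>)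
  have 1: "deriv (\<lambda>s. snd (\<theta> (s, snd z))) (fst z) = partial1 G z * c / snd z"
    using deriv_cong_ev[OF e1 refl] DERIV_imp_deriv[OF d1] by simp
  have d2: "((\<lambda>s. G (fst z, s) * \<alpha> (fst z, s)) has_field_derivative partial2 G z * \<alpha> z) (at (snd z))"
    using DERIV_mult[OF holomorphic_fun_onD(2)[OF G V(2)] \<alpha>] by simp
  have e2: "\<forall>\<^sub>F s in nhds (snd z). fst (\<theta> (fst z, s)) = G (fst z, s) * \<alpha> (fst z, s)"
    using eventually_slices(2)[OF V] by eventually_elim (simp add: \<theta>)
  have 2: "deriv (\<lambda>s. fst (\<theta> (fst z, s))) (snd z) = partial2 G z * \<alpha> z"
    using deriv_cong_ev[OF e2 refl] DERIV_imp_deriv[OF d2] by simp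
  show ?thesis
    using 1 2 nz by (simp add: ext_deriv_def wedge_def dlog_def \<theta>[OF V(2)])
qed

text \<open>On a vertical slice the coefficients of the quadratic are constants, so differentiating
  the equation along it gives (2 A \<alpha> + B) d\<alpha>/dq = 0, and the first factor is nonzero
  at a simple root.\<close>

lemma simple_root_has_derivative_0:
  assumes V: "open V" "z \<in> V" and \<alpha>: "holomorphic_fun_on \<alpha> V"
    and root: "\<And>y. y \<in> V \<Longrightarrow> A (fst y) * \<alpha> y ^ 2 + B (fst y) * \<alpha> y + C (fst y) = 0"
    and simple: "2 * A (fst z) * \<alpha> z + B (fst z) \<noteq> 0"
  shows "((\<lambda>s. \<alpha> (fst z, s)) has_field_derivative 0) (at (snd z))"
proof -
  let ?F = "\<lambda>s. A (fst z) * \<alpha> (fst z, s) ^ 2 + B (fst z) * \<alpha> (fst z, s) + C (fst z)"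
  note D = holomorphic_fun_onD(2)[OF \<alpha> V(2)]
  have "(?F has_field_derivative
      (A (fst z) * (2 * \<alpha> z * partial2 \<alpha> z) + B (fst z) * partial2 \<alpha> z)) (at (snd z))"
    using D by (auto intro!: derivative_eq_intros)
  moreover have "\<forall>\<^sub>F s in nhds (snd z). ?F s = 0"
    using eventually_slices(2)[OF V] by eventually_elim (use root in fastforce)
  then have "(?F has_field_derivative 0) (at (snd z))"
    using DERIV_cong_ev[of "snd z" "snd z" ?F "\<lambda>_. 0" 0 0] by simp
  ultimately have "(2 * A (fst z) * \<alpha> z + B (fst z)) * partial2 \<alpha> z = 0"
    using DERIV_unique by (fastforce simp: algebra_simps)
  with simple D show ?thesis by simp
qed

text \<open>Rotation serves to bring whichever form is proportional to dp to the first
  place.\<close>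

lemma decomposes_on_rotate:
  "decomposes_on W U \<omega>1 \<omega>2 \<omega>3 \<Longrightarrow> decomposes_on W U \<omega>2 \<omega>3 \<omega>1"
  unfolding decomposes_on_def superposition_def by (auto simp: mult_ac)

text \<open>
  When \<open>\<omega>\<^sub>i = a\<^sub>i dp + b\<^sub>i dq\<close>, this is \<open>q\<close> times the coefficient of \<open>dp dq\<^sup>2\<close> in the product.
  It is symmetric in the three forms, so it does not see which of them is a multiple of \<open>dp\<close>.
\<close>

definition web_potential :: "one_form \<Rightarrow> one_form \<Rightarrow> one_form \<Rightarrow> point \<Rightarrow> complex" where
  "web_potential \<omega>1 \<omega>2 \<omega>3 z = snd z *
     (fst (\<omega>1 z) * snd (\<omega>2 z) * snd (\<omega>3 z) + snd (\<omega>1 z) * fst (\<omega>2 z) * snd (\<omega>3 z) +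
      snd (\<omega>1 z) * snd (\<omega>2 z) * fst (\<omega>3 z))"

lemma web_potential_rotate: "web_potential \<omega>2 \<omega>3 \<omega>1 = web_potential \<omega>1 \<omega>2 \<omega>3"
  by (auto simp: web_potential_def fun_eq_iff algebra_simps)

lemma quadratic_coeffs_eq:
  fixes A B C A' B' C' :: complex
  assumes "\<And>x. A * x ^ 2 + B * x + C = A' * x ^ 2 + B' * x + C'"
  shows "A = A'" "B = B'" "C = C'"
proof -
  have "poly [:C, B, A:] x = poly [:C', B', A':] x" for x
    using assms[of x] by (simp add: power2_eq_square algebra_simps)
  then have "[:C, B, A:] = [:C', B', A':]" by (simp add: poly_eq_poly_eq_iff[symmetric] fun_eq_iff)
  then show "A = A'" "B = B'" "C = C'" by simp_all
qed

text \<open>The hypothesis on \<omega>1 at the single point \<open>z0\<close> spreads to a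
  neighbourhood, so that derivatives at \<open>z0\<close> can be computed: by transversality the
  dq-coefficients of \<omega>2 and \<omega>3 are nonzero at \<open>z0\<close>, hence on the open set
  \<open>V\<close>, while the product of all three dq-coefficients vanishes because \<open>W\<close>
  is divisible by dp.\<close>

lemma web_connection_at_vertical:
  assumes W: "\<And>p q dp dq. W (p, q) (dp, dq) = dp * (P p * dq ^ 2 - q * R p * dq * dp + q ^ 2 * S p * dp ^ 2)"
    and dec: "decomposes_on W U \<omega>1 \<omega>2 \<omega>3"
    and z0: "z0 \<in> U" "snd (\<omega>1 z0) = 0"
  defines "G \<equiv> web_potential \<omega>1 \<omega>2 \<omega>3"
    and "\<theta>1 \<equiv> scale_form (wedge \<omega>2 \<omega>3) \<omega>1"
    and "\<theta>2 \<equiv> scale_form (wedge \<omega>3 \<omega>1) \<omega>2"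
    and "\<theta>3 \<equiv> scale_form (wedge \<omega>1 \<omega>2) \<omega>3"
  shows "G z0 \<noteq> 0" "ext_deriv \<theta>1 z0 = wedge (dlog G) \<theta>1 z0"
    "ext_deriv \<theta>2 z0 = wedge (dlog G) \<theta>2 z0" "ext_deriv \<theta>3 z0 = wedge (dlog G) \<theta>3 z0"
proof -
  define a1 b1 a2 b2 a3 b3 where ab: "a1 = (\<lambda>z. fst (\<omega>1 z))" "b1 = (\<lambda>z. snd (\<omega>1 z))"
    "a2 = (\<lambda>z. fst (\<omega>2 z))" "b2 = (\<lambda>z. snd (\<omega>2 z))"
    "a3 = (\<lambda>z. fst (\<omega>3 z))" "b3 = (\<lambda>z. snd (\<omega>3 z))"
  have U: "open U" using dec by (simp add: decomposes_on_def)
  have hol: "holomorphic_fun_on a1 U" "holomorphic_fun_on b1 U" "holomorphic_fun_on a2 U"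
    "holomorphic_fun_on b2 U" "holomorphic_fun_on a3 U" "holomorphic_fun_on b3 U"
    using dec by (auto simp: decomposes_on_def holomorphic_form_on_def ab)
  have wedge: "a1 z * b2 z - b1 z * a2 z \<noteq> 0" "a2 z * b3 z - b2 z * a3 z \<noteq> 0"
    "a3 z * b1 z - b3 z * a1 z \<noteq> 0" if "z \<in> U" for z
    using dec that by (auto simp: decomposes_on_def wedge_def ab)
  from dec obtain h where h0: "\<forall>z\<in>U. h z \<noteq> 0 \<and>
      (\<forall>w. W z w = h z * (eval_form \<omega>1 \<boxtimes> eval_form \<omega>2 \<boxtimes> eval_form \<omega>3) z w)"
    unfolding decomposes_on_def by blast
  have h: "\<And>z. z \<in> U \<Longrightarrow> h z \<noteq> 0"
    "\<And>z dp dq. z \<in> U \<Longrightarrow> W z (dp, dq) =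
      h z * ((a1 z * dp + b1 z * dq) * (a2 z * dp + b2 z * dq) * (a3 z * dp + b3 z * dq))"
    using h0 by (auto simp: superposition_def eval_form_def ab)
  define V where "V = (U \<inter> b2 -` (- {0})) \<inter> (U \<inter> b3 -` (- {0}))"
  have V: "open V" "V \<subseteq> U"
  proof -
    have "open (U \<inter> f -` (- {0}))" if "holomorphic_fun_on f U" for f
      by (rule continuous_open_preimage[OF holomorphic_fun_on_imp_continuous_on[OF that] U]) auto
    then show "open V" unfolding V_def using hol by blast
  qed (auto simp: V_def)
  have z0V: "z0 \<in> V" using z0 wedge[OF z0(1)] by (auto simp: V_def ab)
  have b0: "b2 z \<noteq> 0" "b3 z \<noteq> 0" "b1 z = 0" "a1 z \<noteq> 0" if "z \<in> V" for z
  proof -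
    have z: "z \<in> U" using that V by auto
    show "b2 z \<noteq> 0" "b3 z \<noteq> 0" using that by (auto simp: V_def)
    moreover have "h z * (b1 z * b2 z * b3 z) = 0"
      using W[of "fst z" "snd z" 0 1] h(2)[OF z, of 0 1] by simp
    ultimately show "b1 z = 0" using h(1)[OF z] by simp
    then show "a1 z \<noteq> 0" using wedge[OF z] by auto
  qed
  have coeffs: "P (fst z) = h z * a1 z * b2 z * b3 z"
    "- snd z * R (fst z) = h z * a1 z * (a2 z * b3 z + a3 z * b2 z)"
    "snd z ^ 2 * S (fst z) = h z * a1 z * a2 z * a3 z" if "z \<in> V" for z
  proof -
    have "P (fst z) * x ^ 2 + (- snd z * R (fst z)) * x + snd z ^ 2 * S (fst z) =
      (h z * a1 z * b2 z * b3 z) * x ^ 2 + (h z * a1 z * (a2 z * b3 z + a3 z * b2 z)) * x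
        + h z * a1 z * a2 z * a3 z" for x
    proof -
      have zU: "z \<in> U" using that V(2) by blast
      have "P (fst z) * x ^ 2 + (- snd z * R (fst z)) * x + snd z ^ 2 * S (fst z) = W z (1, x)"
        using W[of "fst z" "snd z" 1 x] by simp
      then show ?thesis
        unfolding h(2)[OF zU] b0(3)[OF that] by (simp add: algebra_simps power2_eq_square)
    qed
    from quadratic_coeffs_eq[OF this] show "P (fst z) = h z * a1 z * b2 z * b3 z"
    "- snd z * R (fst z) = h z * a1 z * (a2 z * b3 z + a3 z * b2 z)"
    "snd z ^ 2 * S (fst z) = h z * a1 z * a2 z * a3 z" by blast+
  qed
  \<comment> \<open>Over q = 0 the web degenerates to P dp dq^2, whose double direction contradicts
    the transversality of \<omega>2 and \<omega>3.\<close>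
  have q0: "snd z \<noteq> 0" if "z \<in> V" for z
  proof
    assume q: "snd z = 0"
    have "a2 z * a3 z = 0" "a2 z * b3 z + a3 z * b2 z = 0"
      using coeffs(2,3)[OF that] q b0[OF that] h(1)[of z] that V(2) by auto
    then show False using b0[OF that] wedge(2)[of z] that V(2) by auto
  qed
  \<comment> \<open>Up to units, \<omega>2 and \<omega>3 are \<alpha> dp + dq / q with \<alpha> one
    of these two functions, whose negatives are the roots \<sigma>.\<close>
  define \<alpha>2 where "\<alpha>2 = (\<lambda>z. a2 z / (b2 z * snd z))"
  define \<alpha>3 where "\<alpha>3 = (\<lambda>z. a3 z / (b3 z * snd z))"
  note holV = hol[THEN holomorphic_fun_on_subset[OF _ V(2)]]
  have h\<alpha>: "holomorphic_fun_on \<alpha>2 V" "holomorphic_fun_on \<alpha>3 V"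
    unfolding \<alpha>2_def \<alpha>3_def using b0 q0
    by (auto intro!: holomorphic_fun_on_intros holV)
  have eq: "P (fst z) * \<alpha>2 z ^ 2 + R (fst z) * \<alpha>2 z + S (fst z) = 0"
    "P (fst z) * \<alpha>3 z ^ 2 + R (fst z) * \<alpha>3 z + S (fst z) = 0"
    "2 * P (fst z) * \<alpha>2 z + R (fst z) \<noteq> 0" "2 * P (fst z) * \<alpha>3 z + R (fst z) \<noteq> 0"
    if z: "z \<in> V" for z
  proof -
    define k where "k = h z * a1 z"
    have k: "k \<noteq> 0" using b0[OF z] h(1)[of z] z V(2) by (auto simp: k_def)
    have P: "P (fst z) = k * b2 z * b3 z" using coeffs(1)[OF z] by (simp add: k_def)
    have "R (fst z) = - (- snd z * R (fst z)) / snd z" using q0[OF z] by simp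
    then have R: "R (fst z) = - (k * (a2 z * b3 z + a3 z * b2 z)) / snd z"
      unfolding coeffs(2)[OF z] k_def .
    have "S (fst z) = (snd z ^ 2 * S (fst z)) / snd z ^ 2" using q0[OF z] by simp
    then have S: "S (fst z) = k * a2 z * a3 z / snd z ^ 2"
      unfolding coeffs(3)[OF z] k_def .
    show "P (fst z) * \<alpha>2 z ^ 2 + R (fst z) * \<alpha>2 z + S (fst z) = 0"
      "P (fst z) * \<alpha>3 z ^ 2 + R (fst z) * \<alpha>3 z + S (fst z) = 0"
      unfolding P R S \<alpha>2_def \<alpha>3_def using b0[OF z] q0[OF z]
      by (simp_all add: field_simps power2_eq_square)
    \<comment> \<open>The derivative of a quadratic at a root is its leading coefficient times the
      difference of the roots, here a nonzero multiple of the wedge of \<omega>2 and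
      \<omega>3.\<close>
    have "2 * P (fst z) * \<alpha>2 z + R (fst z) = k * (a2 z * b3 z - b2 z * a3 z) / snd z"
      "2 * P (fst z) * \<alpha>3 z + R (fst z) = - k * (a2 z * b3 z - b2 z * a3 z) / snd z"
      unfolding P R \<alpha>2_def \<alpha>3_def using b0[OF z] q0[OF z]
      by (simp_all add: field_simps)
    then show "2 * P (fst z) * \<alpha>2 z + R (fst z) \<noteq> 0" "2 * P (fst z) * \<alpha>3 z + R (fst z) \<noteq> 0"
      using k q0[OF z] wedge(2)[of z] z V(2) by auto
  qed
  have d2: "((\<lambda>s. \<alpha>2 (fst z0, s)) has_field_derivative 0) (at (snd z0))"
    by (rule simple_root_has_derivative_0[OF V(1) z0V h\<alpha>(1) eq(1) eq(3)[OF z0V]])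
  have d3: "((\<lambda>s. \<alpha>3 (fst z0, s)) has_field_derivative 0) (at (snd z0))"
    by (rule simple_root_has_derivative_0[OF V(1) z0V h\<alpha>(2) eq(2) eq(4)[OF z0V]])
  have GV: "G z = snd z * a1 z * b2 z * b3 z" if "z \<in> V" for z
    using b0(3)[OF that] by (simp add: G_def web_potential_def ab)
  show nz: "G z0 \<noteq> 0" using GV[OF z0V] b0[OF z0V] q0[OF z0V] by simp
  have hG: "holomorphic_fun_on G V"
    unfolding G_def web_potential_def[abs_def] using holV
    by (auto intro!: holomorphic_fun_on_intros simp: ab)
  \<comment> \<open>Divided by \<open>G\<close>, the three normalised forms are (\<alpha>2 -
    \<alpha>3) dp, - \<alpha>2 dp - dq / q and \<alpha>3 dp + dq / q: all closed, with sum
    zero.\<close>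
  note closed = ext_deriv_multiple_of_closed[OF V(1) z0V hG nz q0[OF z0V]]
  show "ext_deriv \<theta>1 z0 = wedge (dlog G) \<theta>1 z0"
  proof (rule closed[where \<alpha> = "\<lambda>z. \<alpha>2 z - \<alpha>3 z" and c = 0])
    fix z assume z: "z \<in> V"
    show "\<theta>1 z = (G z * (\<alpha>2 z - \<alpha>3 z), G z * 0 / snd z)"
      unfolding \<theta>1_def scale_form_def wedge_def GV[OF z] \<alpha>2_def \<alpha>3_def ab(1)[symmetric, THEN fun_cong]
      using b0[OF z] q0[OF z] by (simp add: ab field_simps)
  qed (use DERIV_diff[OF d2 d3] in simp)
  show "ext_deriv \<theta>2 z0 = wedge (dlog G) \<theta>2 z0"
  proof (rule closed[where \<alpha> = "\<lambda>z. - \<alpha>2 z" and c = "-1"])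
    fix z assume z: "z \<in> V"
    show "\<theta>2 z = (G z * (- \<alpha>2 z), G z * (- 1) / snd z)"
      unfolding \<theta>2_def scale_form_def wedge_def GV[OF z] \<alpha>2_def
      using b0[OF z] q0[OF z] by (simp add: ab field_simps)
  qed (use DERIV_minus[OF d2] in simp)
  show "ext_deriv \<theta>3 z0 = wedge (dlog G) \<theta>3 z0"
  proof (rule closed[where \<alpha> = \<alpha>3 and c = 1])
    fix z assume z: "z \<in> V"
    show "\<theta>3 z = (G z * \<alpha>3 z, G z * 1 / snd z)"
      unfolding \<theta>3_def scale_form_def wedge_def GV[OF z] \<alpha>3_def
      using b0[OF z] q0[OF z] by (simp add: ab field_simps)
  qed (rule d3)
qed

text \<open>At each point some form is proportional to dp, because \<open>W\<close> has no dq^3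
  term. Since \<open>web_potential\<close> is invariant under rotation, the three possible cases
  yield the same form dG/G, which is therefore a connection on all of \<open>U\<close>.\<close>

lemma has_curvature_0:
  assumes W: "\<And>p q dp dq. W (p, q) (dp, dq) = dp * (P p * dq ^ 2 - q * R p * dq * dp + q ^ 2 * S p * dp ^ 2)"
    and dec: "decomposes_on W U \<omega>1 \<omega>2 \<omega>3"
  shows "has_curvature U \<omega>1 \<omega>2 \<omega>3 (\<lambda>z. 0)"
proof -
  define G where "G = web_potential \<omega>1 \<omega>2 \<omega>3"
  have U: "open U" using dec by (simp add: decomposes_on_def)
  have dec2: "decomposes_on W U \<omega>2 \<omega>3 \<omega>1" and dec3: "decomposes_on W U \<omega>3 \<omega>1 \<omega>2"
    using dec decomposes_on_rotate by blast+
  have rot: "web_potential \<omega>2 \<omega>3 \<omega>1 = G" "web_potential \<omega>3 \<omega>1 \<omega>2 = G"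
    unfolding G_def by (rule web_potential_rotate, rule web_potential_rotate[symmetric])
  have vert: "snd (\<omega>1 z) = 0 \<or> snd (\<omega>2 z) = 0 \<or> snd (\<omega>3 z) = 0" if "z \<in> U" for z
  proof -
    obtain h where "\<forall>z\<in>U. h z \<noteq> 0 \<and>
        (\<forall>w. W z w = h z * (eval_form \<omega>1 \<boxtimes> eval_form \<omega>2 \<boxtimes> eval_form \<omega>3) z w)"
      using dec unfolding decomposes_on_def by blast
    with that have "h z \<noteq> 0" "W z (0, 1) = h z * (snd (\<omega>1 z) * snd (\<omega>2 z) * snd (\<omega>3 z))"
      by (simp_all add: superposition_def eval_form_def)
    then show ?thesis using W[of "fst z" "snd z" 0 1] by simp
  qed
  have conn: "G z \<noteq> 0 \<and>
      ext_deriv (scale_form (wedge \<omega>2 \<omega>3) \<omega>1) z = wedge (dlog G) (scale_form (wedge \<omega>2 \<omega>3) \<omega>1) z \<and>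
      ext_deriv (scale_form (wedge \<omega>3 \<omega>1) \<omega>2) z = wedge (dlog G) (scale_form (wedge \<omega>3 \<omega>1) \<omega>2) z \<and>
      ext_deriv (scale_form (wedge \<omega>1 \<omega>2) \<omega>3) z = wedge (dlog G) (scale_form (wedge \<omega>1 \<omega>2) \<omega>3) z"
    if z: "z \<in> U" for z
    using vert[OF z] web_connection_at_vertical[OF W dec z] web_connection_at_vertical[OF W dec2 z]
      web_connection_at_vertical[OF W dec3 z] unfolding rot G_def[symmetric] by blast
  have hG: "holomorphic_fun_on G U"
    using dec unfolding G_def web_potential_def decomposes_on_def holomorphic_form_on_def
    by (auto intro!: holomorphic_fun_on_intros)
  have "web_connection U \<omega>1 \<omega>2 \<omega>3 (dlog G)"
    unfolding web_connection_def Let_def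
    using holomorphic_form_on_dlog[OF U hG] conn by blast
  moreover have "\<forall>z\<in>U. 0 = ext_deriv (dlog G) z"
    using ext_deriv_dlog[OF U hG] conn by simp
  ultimately show ?thesis unfolding has_curvature_def by blast
qed

section \<open>Generic decomposition of the dual web\<close>

lemma quadratic_web_decomposes:
  fixes P R S :: "complex poly"
  assumes W: "\<And>p q dp dq. W (p, q) (dp, dq) =
      dp * (poly P p * dq ^ 2 - q * poly R p * dq * dp + q ^ 2 * poly S p * dp ^ 2)"
    and nz: "q0 \<noteq> 0" "poly P p0 \<noteq> 0" "poly (R ^ 2 - 4 * P * S) p0 \<noteq> 0"
  shows "\<exists>U \<omega>1 \<omega>2 \<omega>3. (p0, q0) \<in> U \<and> decomposes_on W U \<omega>1 \<omega>2 \<omega>3"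
proof -
  define D where "D = R ^ 2 - 4 * P * S"
  define d where "d = (\<lambda>p. poly D p / poly D p0)"
  \<comment> \<open>A local square root of the discriminant: after division by its value at
    \<open>p0\<close> the argument is 1 there, and on the half-plane Re > 0 the principal root is
    holomorphic.\<close>
  define r where "r = (\<lambda>p. csqrt (poly D p0) * csqrt (d p))"
  define U :: "point set" where
    "U = {z. snd z \<noteq> 0} \<inter> {z. poly P (fst z) \<noteq> 0} \<inter> {z. Re (d (fst z)) > 0}"
  have D0: "poly D p0 \<noteq> 0" using nz by (simp add: D_def)
  have r2: "r p ^ 2 = poly R p ^ 2 - 4 * poly P p * poly S p" for p
    using D0 by (simp add: r_def power_mult_distrib d_def D_def)
  have r0: "r (fst z) \<noteq> 0" if "z \<in> U" for z
  proof -
    have "d (fst z) \<noteq> 0" using that by (auto simp: U_def)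
    then show ?thesis using D0 by (simp add: r_def)
  qed
  have U: "open U"
    unfolding U_def d_def
    by (intro open_Int open_Collect_neq open_Collect_less continuous_intros) (use D0 in auto)
  have hr: "holomorphic_fun_on (\<lambda>z. r (fst z)) U"
  proof (rule holomorphic_fun_on_compose_fst)
    fix z assume "z \<in> U"
    then have pos: "d (fst z) \<notin> \<real>\<^sub>\<le>\<^sub>0" by (auto simp: U_def complex_nonpos_Reals_iff)
    have "poly D field_differentiable at (fst z)"
      using poly_DERIV field_differentiable_def by blast
    then have "d field_differentiable at (fst z)"
      unfolding d_def using D0 by (intro field_differentiable_divide field_differentiable_const) auto
    then have "(csqrt \<circ> d) field_differentiable at (fst z)"
      by (rule field_differentiable_compose) (rule field_differentiable_at_csqrt[OF pos])
    then show "r field_differentiable at (fst z)"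
      unfolding r_def comp_def by (intro field_differentiable_mult field_differentiable_const)
  qed
  have hp: "holomorphic_fun_on (\<lambda>z. poly Q (fst z)) U" for Q
    by (rule holomorphic_fun_on_compose_fst) (use poly_DERIV field_differentiable_def in blast)
  \<comment> \<open>For \<epsilon> = 1 and \<epsilon> = -1, the quadratic formula gives -
    \<open>s\<close> \<epsilon> as the two values of dq/dp.\<close>
  define s where "s = (\<lambda>\<epsilon> z. - (snd z * (poly R (fst z) + \<epsilon> * r (fst z)) / (2 * poly P (fst z))))"
  have hs: "holomorphic_fun_on (s \<epsilon>) U" for \<epsilon>
    unfolding s_def by (intro holomorphic_fun_on_intros hp hr) (auto simp: U_def)
  have diff: "s 1 z - s (- 1) z = - (snd z * r (fst z) / poly P (fst z))" if "z \<in> U" for z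
    using that by (simp add: U_def s_def field_simps)
  have ne: "s 1 z \<noteq> s (- 1) z" if "z \<in> U" for z
    using diff[OF that] r0[OF that] that by (auto simp: U_def)
  have factor: "W z w = poly P (fst z) * (fst w * (s 1 z * fst w + snd w) * (s (- 1) z * fst w + snd w))"
    if z: "z \<in> U" for z w
  proof -
    have P: "poly P (fst z) \<noteq> 0" using z by (simp add: U_def)
    have sum: "poly P (fst z) * (s 1 z + s (- 1) z) = - snd z * poly R (fst z)"
      using P by (simp add: s_def field_simps)
    have "s 1 z * s (- 1) z = snd z ^ 2 * (poly R (fst z) ^ 2 - r (fst z) ^ 2) / (4 * poly P (fst z) ^ 2)"
      by (simp add: s_def power2_eq_square algebra_simps)
    then have prod: "poly P (fst z) * (s 1 z * s (- 1) z) = snd z ^ 2 * poly S (fst z)"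
      unfolding r2 using P by (simp add: power2_eq_square)
    have "poly P (fst z) * (fst w * (s 1 z * fst w + snd w) * (s (- 1) z * fst w + snd w)) =
      fst w * (poly P (fst z) * snd w ^ 2 + poly P (fst z) * (s 1 z + s (- 1) z) * snd w * fst w +
        poly P (fst z) * (s 1 z * s (- 1) z) * fst w ^ 2)"
      by (simp add: algebra_simps power2_eq_square)
    moreover have "W z w = fst w * (poly P (fst z) * snd w ^ 2 + - snd z * poly R (fst z) * snd w * fst w +
        snd z ^ 2 * poly S (fst z) * fst w ^ 2)"
      using W[of "fst z" "snd z" "fst w" "snd w"] by simp
    ultimately show ?thesis unfolding sum prod by (rule trans[OF _ sym, rotated])
  qed
  have "decomposes_on W U (\<lambda>z. (1, 0)) (\<lambda>z. (s 1 z, 1)) (\<lambda>z. (s (- 1) z, 1))"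
    unfolding decomposes_on_def
  proof (intro conjI)
    show "\<exists>h. \<forall>z\<in>U. h z \<noteq> 0 \<and> (\<forall>w. W z w = h z * (eval_form (\<lambda>z. (1, 0)) \<boxtimes>
        eval_form (\<lambda>z. (s 1 z, 1)) \<boxtimes> eval_form (\<lambda>z. (s (- 1) z, 1))) z w)"
      by (rule exI[of _ "\<lambda>z. poly P (fst z)"])
        (use factor in \<open>auto simp: superposition_def eval_form_def U_def\<close>)
  qed (use U ne hs in \<open>auto simp: holomorphic_form_on_def wedge_def holomorphic_fun_on_const\<close>)
  moreover have "(p0, q0) \<in> U" using nz D0 by (simp add: U_def d_def)
  ultimately show ?thesis by blast
qed

text \<open>Decompositions exist away from finitely many values of p and from q = 0, that is, on a
  product of two dense sets.\<close>

lemma three_web_quadratic: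
  fixes P R S :: "complex poly"
  assumes W: "\<And>p q dp dq. W (p, q) (dp, dq) =
      dp * (poly P p * dq ^ 2 - q * poly R p * dq * dp + q ^ 2 * poly S p * dp ^ 2)"
    and nz: "P \<noteq> 0" "R ^ 2 - 4 * P * S \<noteq> 0"
  shows "three_web W"
proof -
  define F where "F = {p. poly (P * (R ^ 2 - 4 * P * S)) p = 0}"
  have "finite F" unfolding F_def by (rule poly_roots_finite) (use nz in simp)
  then have F: "closure (- F) = UNIV"
    by (simp add: closure_complement empty_interior_finite)
  have 0: "closure (- {0::complex}) = UNIV"
    by (simp add: closure_complement empty_interior_finite)
  have "(- F) \<times> (- {0}) \<subseteq> {z. \<exists>U \<omega>1 \<omega>2 \<omega>3. z \<in> U \<and> decomposes_on W U \<omega>1 \<omega>2 \<omega>3}"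
    using quadratic_web_decomposes[OF W] by (auto simp: F_def)
  from closure_mono[OF this] show ?thesis
    unfolding three_web_def closure_Times F 0 by auto
qed

text \<open>
  For a form \<open>A Z dX + B Z dY + \<dots>\<close> with binary quadratic forms \<open>A\<close>, \<open>B\<close>, the discriminant of
  the dual web is that of the pencil \<open>A + p B\<close>: restricting to the line \<open>y = p x - q\<close> is a linear
  change of the variables \<open>(x, q)\<close>.
\<close>

lemma flat_web_legendre:
  fixes \<Omega> :: "complex^3 \<Rightarrow> complex^3"
  assumes A: "\<And>x y. \<Omega> (vector [x, y, 1]) $ 1 = a0 * x ^ 2 + a1 * x * y + a2 * y ^ 2"
    and B: "\<And>x y. \<Omega> (vector [x, y, 1]) $ 2 = b0 * x ^ 2 + b1 * x * y + b2 * y ^ 2"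
    and P: "[:a0, a1 + b0, a2 + b1, b2:] \<noteq> 0"
    and D: "[:a1 ^ 2 - 4 * a0 * a2, 2 * a1 * b1 - 4 * (a0 * b2 + a2 * b0), b1 ^ 2 - 4 * b0 * b2:] \<noteq> 0"
  shows "flat_web (leg_line (vector [0, 0, 1]) \<boxtimes> leg_foliation 2 \<Omega>)"
proof -
  \<comment> \<open>These come from the coefficients in x of A(x, p x - q) + p B(x, p x - q), with
    the powers of q and the sign split off. In particular \<open>poly P p\<close> is the value at
    (1, p) of the cubic X A + Y B.\<close>
  define P R S where "P = [:a0, a1 + b0, a2 + b1, b2:]" "R = [:a1, 2 * a2 + b1, 2 * b2:]"
    "S = [:a2, b2:]"
  have "legendre_poly \<Omega> p q = [:q ^ 2 * poly S p, - q * poly R p, poly P p:]" for p q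
    unfolding legendre_poly_def
  proof (rule the_equality)
    show *: "\<forall>x. poly [:q ^ 2 * poly S p, - q * poly R p, poly P p:] x =
      \<Omega> (vector [x, p * x - q, 1]) $ 1 + p * \<Omega> (vector [x, p * x - q, 1]) $ 2"
      by (simp add: A B P_R_S_def algebra_simps power2_eq_square)
    fix f assume "\<forall>x. poly f x = \<Omega> (vector [x, p * x - q, 1]) $ 1 + p * \<Omega> (vector [x, p * x - q, 1]) $ 2"
    then show "f = [:q ^ 2 * poly S p, - q * poly R p, poly P p:]"
      using * by (intro poly_eq_poly_eq_iff[THEN iffD1] ext) simp
  qed
  then have W: "(leg_line (vector [0, 0, 1]) \<boxtimes> leg_foliation 2 \<Omega>) (p, q) (dp, dq) =
      dp * (poly P p * dq ^ 2 - q * poly R p * dq * dp + q ^ 2 * poly S p * dp ^ 2)" for p q dp dq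
    by (simp add: superposition_def leg_line_def leg_foliation_def vector_3 numeral_2_eq_2 algebra_simps)
  have "P \<noteq> 0" "R ^ 2 - 4 * P * S \<noteq> 0"
  proof -
    have "R ^ 2 - 4 * P * S = R * R - smult 4 (P * S)"
      by (simp add: power2_eq_square numeral_poly)
    also have "\<dots> = [:a1 ^ 2 - 4 * a0 * a2, 2 * a1 * b1 - 4 * (a0 * b2 + a2 * b0), b1 ^ 2 - 4 * b0 * b2:]"
      by (simp add: P_R_S_def power2_eq_square algebra_simps)
    finally show "R ^ 2 - 4 * P * S \<noteq> 0" using D by simp
    show "P \<noteq> 0" using P by (simp add: P_R_S_def)
  qed
  from three_web_quadratic[OF W this] has_curvature_0[OF W] show ?thesis
    unfolding flat_web_def by blast
qed

section \<open>Homogeneous foliations\<close>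

lemma polynomial_fun_linear_subst:
  assumes "polynomial_fun f" shows "polynomial_fun (\<lambda>v. f (M *v v))"
  using assms
proof induction
  case (coord i)
  have "polynomial_fun (\<lambda>v. M $ i $ 1 * v $ 1 + M $ i $ 2 * v $ 2 + M $ i $ 3 * v $ 3)"
    by (intro polynomial_fun.intros)
  then show ?case by (simp add: matrix_vector_mult_def sum_3)
qed (auto intro: polynomial_fun.intros)

lemma polynomial_fun_sum:
  "finite I \<Longrightarrow> (\<And>i. i \<in> I \<Longrightarrow> polynomial_fun (f i)) \<Longrightarrow> polynomial_fun (\<lambda>v. \<Sum>i\<in>I. f i v)"
  by (induction I rule: finite_induct) (auto intro: polynomial_fun.intros)

lemma polynomial_fun_power: "polynomial_fun f \<Longrightarrow> polynomial_fun (\<lambda>v. f v ^ n)"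
  by (induction n) (auto intro: polynomial_fun.intros)

lemma pullback_nth: "pullback M \<omega> v $ i = (\<Sum>j\<in>UNIV. M $ j $ i * \<omega> (M *v v) $ j)"
  by (simp add: pullback_def matrix_vector_mult_def transpose_def del: transpose_matrix_vector)

lemma matrix_inv_mult:
  assumes "invertible A"
  shows "A ** matrix_inv A = mat 1" "matrix_inv A ** A = mat 1"
  using someI_ex[OF assms[unfolded invertible_def]] unfolding matrix_inv_def by blast+

text \<open>The Euler relation survives because the pairing of the pulled-back form with
  \<open>v\<close> is that of \<omega> with \<open>M *v v\<close>. A common factor \<open>g\<close>
  upstairs gives the common factor \<open>g\<close> composed with the inverse of \<open>M\<close>
  downstairs, which must be constant.\<close>

lemma foliation_pullback:
  assumes \<omega>: "foliation d \<omega>" and M: "invertible M"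
  shows "foliation d (pullback M \<omega>)"
  unfolding foliation_def
proof (intro conjI allI)
  have pf: "polynomial_fun (\<lambda>v. \<omega> v $ j)" and hom: "\<omega> (t *s v) $ j = t ^ (d + 1) * \<omega> v $ j" for j t v
    using \<omega> unfolding foliation_def homogeneous_poly_def by blast+
  fix i
  have "polynomial_fun (\<lambda>v. pullback M \<omega> v $ i)"
    unfolding pullback_nth
    by (intro polynomial_fun_sum polynomial_fun.intros polynomial_fun_linear_subst[OF pf]) simp
  moreover have "pullback M \<omega> (t *s v) $ i = t ^ (d + 1) * pullback M \<omega> v $ i" for t v
    unfolding pullback_nth by (simp add: vector_scalar_commute hom sum_distrib_left mult_ac)
  ultimately show "homogeneous_poly (d + 1) (\<lambda>v. pullback M \<omega> v $ i)"
    unfolding homogeneous_poly_def by blast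
next
  fix v
  have "(\<Sum>i\<in>UNIV. \<omega> (M *v v) $ i * (M *v v) $ i) = 0"
    using \<omega> unfolding foliation_def by blast
  then show "(\<Sum>i\<in>UNIV. pullback M \<omega> v $ i * v $ i) = 0"
    unfolding pullback_nth by (simp add: sum_3 matrix_vector_mult_def[of M v] algebra_simps)
next
  define N where "N = matrix_inv M"
  have MN: "M *v (N *v u) = u" "N *v (M *v u) = u" for u
    using M by (simp_all add: N_def matrix_vector_mul_assoc matrix_inv_mult)
  have \<omega>N: "\<omega> u $ i = (\<Sum>j\<in>UNIV. N $ j $ i * pullback M \<omega> (N *v u) $ j)" for u i
  proof -
    have "transpose N *v pullback M \<omega> (N *v u) = transpose (M ** N) *v \<omega> u"
      unfolding pullback_def MN
      by (simp add: matrix_vector_mul_assoc matrix_transpose_mul del: transpose_matrix_vector)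
    also have "M ** N = mat 1" using M by (simp add: N_def matrix_inv_mult)
    finally have eq: "transpose N *v pullback M \<omega> (N *v u) = \<omega> u"
      by (simp add: transpose_mat del: transpose_matrix_vector)
    show ?thesis
      unfolding eq[symmetric]
      by (simp add: transpose_def matrix_vector_mult_def[of "\<chi> i j. N $ j $ i"] del: transpose_matrix_vector)
  qed
  show "no_common_factor (pullback M \<omega>)"
    unfolding no_common_factor_def
  proof (intro allI impI, elim conjE)
    fix g assume g: "polynomial_fun g"
      and "\<forall>i. \<exists>h. polynomial_fun h \<and> (\<forall>v. pullback M \<omega> v $ i = g v * h v)"
    then obtain h where h: "\<And>i. polynomial_fun (h i)" "\<And>i v. pullback M \<omega> v $ i = g v * h i v"
      by metis
    have "\<exists>k. polynomial_fun k \<and> (\<forall>u. \<omega> u $ i = g (N *v u) * k u)" for i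
    proof (intro exI conjI allI)
      show "polynomial_fun (\<lambda>u. \<Sum>j\<in>UNIV. N $ j $ i * h j (N *v u))"
        by (intro polynomial_fun_sum polynomial_fun.intros polynomial_fun_linear_subst[OF h(1)]) simp
      show "\<omega> u $ i = g (N *v u) * (\<Sum>j\<in>UNIV. N $ j $ i * h j (N *v u))" for u
        unfolding \<omega>N h(2) by (simp add: sum_distrib_left mult_ac)
    qed
    then obtain c where "\<And>u. g (N *v u) = c"
      using \<omega> polynomial_fun_linear_subst[OF g] unfolding foliation_def no_common_factor_def by blast
    then have "g v = c" for v using MN(2)[of v] by metis
    then show "\<exists>c. \<forall>v. g v = c" by blast
  qed
qed

section \<open>Polynomials as sums of monomials, and weights\<close>

text \<open>A term \<open>(c, i, j, k)\<close> of the list stands for the monomial \<open>c X\<^sup>i Y\<^sup>j Z\<^sup>k\<close>.\<close>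

definition mono_sum :: "(complex \<times> nat \<times> nat \<times> nat) list \<Rightarrow> complex^3 \<Rightarrow> complex" where
  "mono_sum xs v = (\<Sum>(c, i, j, k)\<leftarrow>xs. c * v $ 1 ^ i * v $ 2 ^ j * v $ 3 ^ k)"

lemma mono_sum_simps [simp]:
  "mono_sum [] v = 0"
  "mono_sum ((c, i, j, k) # xs) v = c * v $ 1 ^ i * v $ 2 ^ j * v $ 3 ^ k + mono_sum xs v"
  "mono_sum (xs @ ys) v = mono_sum xs v + mono_sum ys v"
  by (simp_all add: mono_sum_def)

lemma polynomial_fun_mono_sum: "polynomial_fun (mono_sum xs)"
proof (induction xs)
  case Nil
  show ?case using polynomial_fun.const[of 0] by (simp add: mono_sum_def[abs_def])
next
  case (Cons x xs)
  obtain c i j k where "x = (c, i, j, k)" by (cases x)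
  moreover have "polynomial_fun (\<lambda>v. c * v $ 1 ^ i * v $ 2 ^ j * v $ 3 ^ k + mono_sum xs v)"
    by (intro polynomial_fun.intros polynomial_fun_power Cons.IH)
  ultimately show ?case by (simp add: mono_sum_def[abs_def])
qed

lemma mono_sum_mult: "\<exists>zs. \<forall>v. mono_sum zs v = mono_sum xs v * mono_sum ys v"
proof (induction xs)
  case Nil
  show ?case by (intro exI[of _ "[]"]) simp
next
  case (Cons x xs)
  obtain c i j k where x: "x = (c, i, j, k)" by (cases x)
  obtain zs where zs: "\<And>v. mono_sum zs v = mono_sum xs v * mono_sum ys v" using Cons.IH by blast
  have "mono_sum (map (\<lambda>(c', i', j', k'). (c * c', i + i', j + j', k + k')) ys) v =
      (c * v $ 1 ^ i * v $ 2 ^ j * v $ 3 ^ k) * mono_sum ys v" for v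
    by (induction ys) (auto simp: algebra_simps power_add)
  then show ?case
    by (intro exI[of _ "map (\<lambda>(c', i', j', k'). (c * c', i + i', j + j', k + k')) ys @ zs"])
      (simp add: x zs algebra_simps)
qed

lemma polynomial_fun_eq_mono_sum:
  assumes "polynomial_fun f" shows "\<exists>xs. \<forall>v. f v = mono_sum xs v"
  using assms
proof induction
  case (const c)
  show ?case by (intro exI[of _ "[(c, 0, 0, 0)]"]) simp
next
  case (coord i)
  have "\<forall>v. v $ 1 = mono_sum [(1, 1, 0, 0)] v" "\<forall>v. v $ 2 = mono_sum [(1, 0, 1, 0)] v"
    "\<forall>v. v $ 3 = mono_sum [(1, 0, 0, 1)] v" by simp_all
  then show ?case using exhaust_3[of i] by blast
next
  case (add f g)
  then show ?case using mono_sum_simps(3) by metis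
next
  case (mult f g)
  then show ?case using mono_sum_mult by metis
qed

lemma poly_eqI_nonzero:
  fixes p q :: "complex poly"
  assumes "\<And>s. s \<noteq> 0 \<Longrightarrow> poly p s = poly q s" shows "p = q"
proof (rule ccontr)
  assume "p \<noteq> q"
  then have "finite {s. poly (p - q) s = 0}" by (intro poly_roots_finite) simp
  moreover have "- {0} \<subseteq> {s. poly (p - q) s = 0}" using assms by auto
  ultimately have "finite (- {0 :: complex})" by (rule finite_subset[rotated])
  then show False using infinite_UNIV_char_0 by (metis finite_compl finite.simps)
qed

text \<open>For fixed \<open>v\<close> both sides are polynomials in \<open>s\<close>, and comparing
  coefficients of \<open>s ^ m\<close> keeps exactly the terms of weight \<open>m\<close>. A list
  may repeat or cancel monomials, so terms of other weight are filtered out instead of being shown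
  to have zero coefficient.\<close>

lemma mono_sum_weighted:
  assumes "\<And>s. s \<noteq> 0 \<Longrightarrow>
    s ^ e * mono_sum xs (vector [s ^ w1 * v $ 1, s ^ w2 * v $ 2, s ^ w3 * v $ 3]) = s ^ m * mono_sum xs v"
  shows "mono_sum xs v = mono_sum (filter (\<lambda>(c, i, j, k). e + w1 * i + w2 * j + w3 * k = m) xs) v"
proof -
  define p where "p ys = (\<Sum>(c, i, j, k)\<leftarrow>ys.
    monom (c * v $ 1 ^ i * v $ 2 ^ j * v $ 3 ^ k) (e + w1 * i + w2 * j + w3 * k))" for ys
  have "poly (p ys) s = s ^ e * mono_sum ys (vector [s ^ w1 * v $ 1, s ^ w2 * v $ 2, s ^ w3 * v $ 3])" for ys s
    by (induction ys) (auto simp: p_def poly_monom vector_3 algebra_simps power_add power_mult[symmetric] power_mult_distrib)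
  then have "p xs = monom (mono_sum xs v) m"
    using assms by (intro poly_eqI_nonzero) (simp add: poly_monom)
  then have "mono_sum xs v = coeff (p xs) m" by simp
  also have "coeff (p ys) m = mono_sum (filter (\<lambda>(c, i, j, k). e + w1 * i + w2 * j + w3 * k = m) ys) v" for ys
    by (induction ys) (auto simp: p_def)
  finally show ?thesis .
qed

text \<open>Compare leading coefficients in p(l X) = p(l) p(X); the exponent is the degree.\<close>

lemma polynomial_character:
  fixes p :: "complex poly"
  assumes mult: "\<And>l m. l \<noteq> 0 \<Longrightarrow> m \<noteq> 0 \<Longrightarrow> poly p (l * m) = poly p l * poly p m" and p: "p \<noteq> 0"
  shows "\<exists>n. \<forall>l. l \<noteq> 0 \<longrightarrow> poly p l = l ^ n"
proof (intro exI allI impI)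
  fix l :: complex assume l: "l \<noteq> 0"
  have "pcompose p [:0, l:] = smult (poly p l) p"
    by (rule poly_eqI_nonzero) (use l mult[OF l] in \<open>simp add: poly_pcompose mult.commute\<close>)
  then have "l ^ degree p * coeff p (degree p) = poly p l * coeff p (degree p)"
    by (metis coeff_pcompose_linear coeff_smult)
  then show "poly p l = l ^ degree p" using p by simp
qed

lemma no_common_factorD:
  assumes "no_common_factor \<Omega>" "polynomial_fun g" "\<And>i. polynomial_fun (h i)"
    "\<And>i v. \<Omega> v $ i = g v * h i v"
  shows "g u = g v"
proof -
  obtain c where "\<forall>v. g v = c"
    using assms unfolding no_common_factor_def by blast
  then show ?thesis by simp
qed

text \<open>Z would be a nonconstant common factor. Taking all cofactors zero, this also shows that
  the form is not identically zero.\<close>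

lemma no_common_factor_third_coord:
  assumes "no_common_factor \<Omega>"
    and "\<And>v. \<Omega> v $ 1 = v $ 3 * h1 v" "\<And>v. \<Omega> v $ 2 = v $ 3 * h2 v" "\<And>v. \<Omega> v $ 3 = v $ 3 * h3 v"
    and "polynomial_fun h1" "polynomial_fun h2" "polynomial_fun h3"
  shows False
proof -
  define h where "h i = (if i = 1 then h1 else if i = 2 then h2 else h3)" for i :: 3
  have "(axis 3 1 :: complex^3) $ 3 = (0 :: complex^3) $ 3"
  proof (rule no_common_factorD[OF assms(1), where g = "\<lambda>v. v $ 3" and h = h])
    show "polynomial_fun (h i)" for i using assms(5-7) by (simp add: h_def)
    show "\<Omega> v $ i = v $ 3 * h i v" for i v
      using exhaust_3[of i] assms(2-4) by (auto simp: h_def)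
  qed (rule polynomial_fun.intros)
  then show False by (simp add: axis_def)
qed

lemma mono_sum_third_coord:
  assumes "\<forall>(c, i, j, k)\<in>set xs. k > 0"
  shows "mono_sum xs v = v $ 3 * mono_sum (map (\<lambda>(c, i, j, k). (c, i, j, k - 1)) xs) v"
  using assms
proof (induction xs)
  case (Cons x xs)
  obtain c i j k where x: "x = (c, i, j, k)" by (cases x)
  with Cons.prems obtain k' where "k = Suc k'" by (cases k) auto
  with Cons x show ?case by (auto simp: algebra_simps)
qed simp

lemma mono_sum_quadratic:
  assumes "\<forall>(c, i, j, k)\<in>set xs. i + j = 2 \<and> k = 1"
  shows "\<exists>a0 a1 a2. \<forall>v. mono_sum xs v = v $ 3 * (a0 * v $ 1 ^ 2 + a1 * v $ 1 * v $ 2 + a2 * v $ 2 ^ 2)"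
  using assms
proof (induction xs)
  case Nil
  show ?case by (intro exI[of _ 0]) simp
next
  case (Cons x xs)
  obtain c i j k where x: "x = (c, i, j, k)" by (cases x)
  obtain a0 a1 a2 where IH:
    "\<And>v. mono_sum xs v = v $ 3 * (a0 * v $ 1 ^ 2 + a1 * v $ 1 * v $ 2 + a2 * v $ 2 ^ 2)"
    using Cons by auto
  have k: "k = 1" and ij: "i + j = 2" using Cons.prems x by auto
  from ij consider "i = 2" "j = 0" | "i = 1" "j = 1" | "i = 0" "j = 2" by linarith
  then show ?case
  proof cases
    case 1
    show ?thesis by (intro exI[of _ "a0 + c"] exI[of _ a1] exI[of _ a2]) (simp add: x k 1 IH algebra_simps)
  next
    case 2
    show ?thesis by (intro exI[of _ a0] exI[of _ "a1 + c"] exI[of _ a2]) (simp add: x k 2 IH algebra_simps)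
  next
    case 3
    show ?thesis by (intro exI[of _ a0] exI[of _ a1] exI[of _ "a2 + c"]) (simp add: x k 3 IH algebra_simps)
  qed
qed

lemma mono_sum_cubic:
  assumes "\<forall>(c, i, j, k)\<in>set xs. i + j = 3 \<and> k = 0"
  shows "\<exists>a0 a1 a2 a3. \<forall>v. mono_sum xs v =
    a0 * v $ 1 ^ 3 + a1 * v $ 1 ^ 2 * v $ 2 + a2 * v $ 1 * v $ 2 ^ 2 + a3 * v $ 2 ^ 3"
  using assms
proof (induction xs)
  case Nil
  show ?case by (intro exI[of _ 0]) simp
next
  case (Cons x xs)
  obtain c i j k where x: "x = (c, i, j, k)" by (cases x)
  obtain a0 a1 a2 a3 where IH: "\<And>v. mono_sum xs v =
    a0 * v $ 1 ^ 3 + a1 * v $ 1 ^ 2 * v $ 2 + a2 * v $ 1 * v $ 2 ^ 2 + a3 * v $ 2 ^ 3"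
    using Cons by auto
  have k: "k = 0" and ij: "i + j = 3" using Cons.prems x by auto
  from ij consider "i = 3" "j = 0" | "i = 2" "j = 1" | "i = 1" "j = 2" | "i = 0" "j = 3" by linarith
  then show ?case
  proof cases
    case 1
    show ?thesis
      by (intro exI[of _ "a0 + c"] exI[of _ a1] exI[of _ a2] exI[of _ a3]) (simp add: x k 1 IH algebra_simps)
  next
    case 2
    show ?thesis
      by (intro exI[of _ a0] exI[of _ "a1 + c"] exI[of _ a2] exI[of _ a3]) (simp add: x k 2 IH algebra_simps)
  next
    case 3
    show ?thesis
      by (intro exI[of _ a0] exI[of _ a1] exI[of _ "a2 + c"] exI[of _ a3]) (simp add: x k 3 IH algebra_simps)
  next
    case 4
    show ?thesis
      by (intro exI[of _ a0] exI[of _ a1] exI[of _ a2] exI[of _ "a3 + c"]) (simp add: x k 4 IH algebra_simps)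
  qed
qed

section \<open>Action of homotheties on the coefficients\<close>

lemma pullback_homothety:
  "pullback (homothety l) \<Omega> v $ 1 = l * \<Omega> (vector [l * v $ 1, l * v $ 2, v $ 3]) $ 1"
  "pullback (homothety l) \<Omega> v $ 2 = l * \<Omega> (vector [l * v $ 1, l * v $ 2, v $ 3]) $ 2"
  "pullback (homothety l) \<Omega> v $ 3 = \<Omega> (vector [l * v $ 1, l * v $ 2, v $ 3]) $ 3"
proof -
  have "homothety l *v v = vector [l * v $ 1, l * v $ 2, v $ 3]"
    by (simp add: vec_eq_iff forall_3 homothety_def matrix_vector_mult_def sum_3 vector_3)
  then show "pullback (homothety l) \<Omega> v $ 1 = l * \<Omega> (vector [l * v $ 1, l * v $ 2, v $ 3]) $ 1"
  "pullback (homothety l) \<Omega> v $ 2 = l * \<Omega> (vector [l * v $ 1, l * v $ 2, v $ 3]) $ 2"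
  "pullback (homothety l) \<Omega> v $ 3 = \<Omega> (vector [l * v $ 1, l * v $ 2, v $ 3]) $ 3"
    by (simp_all add: pullback_nth sum_3 homothety_def vector_3)
qed

text \<open>Filtering with weights (1, 1, 1) fixes the total degree, and with weights (1, 1, 0) the
  degree in X and Y. The offset \<open>e\<close> accounts for the differential: 1 for dX and dY, 0
  for dZ.\<close>

lemma mono_sum_bihomogeneous:
  assumes pf: "polynomial_fun f"
    and hom: "\<And>t v. f (t *s v) = t ^ d * f v"
    and inv: "\<And>l v. l \<noteq> 0 \<Longrightarrow> l ^ e * f (vector [l * v $ 1, l * v $ 2, v $ 3]) = l ^ n * f v"
  shows "\<exists>xs. (\<forall>v. f v = mono_sum xs v) \<and> (\<forall>(c, i, j, k)\<in>set xs. i + j + k = d \<and> e + i + j = n)"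
proof -
  obtain xs where xs: "\<And>v. f v = mono_sum xs v" using polynomial_fun_eq_mono_sum[OF pf] by blast
  define ys where "ys = filter (\<lambda>(c, i, j, k). 0 + 1 * i + 1 * j + 1 * k = d) xs"
  define zs where "zs = filter (\<lambda>(c, i, j, k). e + 1 * i + 1 * j + 0 * k = n) ys"
  have scale: "t *s v = vector [t * v $ 1, t * v $ 2, t * v $ 3]" for t :: complex and v :: "complex^3"
    by (simp add: vec_eq_iff forall_3 vector_3)
  have ys: "f v = mono_sum ys v" for v
    unfolding ys_def xs
    by (rule mono_sum_weighted) (use hom[unfolded scale] xs in simp)
  have zs: "f v = mono_sum zs v" for v
    unfolding zs_def ys by (rule mono_sum_weighted) (use inv ys in simp)
  show ?thesis
    by (rule exI[of _ zs]) (use zs in \<open>auto simp: zs_def ys_def\<close>)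
qed

text \<open>The factors \<kappa> chosen separately for each ratio are multiplicative, since
  homotheties compose. At a point where \<Omega> is nonzero, \<kappa> is a polynomial in the ratio,
  hence a power of it.\<close>

lemma homothety_character:
  assumes pf: "\<And>i. polynomial_fun (\<lambda>v. \<Omega> v $ i)" and nz: "\<Omega> v0 \<noteq> 0"
    and inv: "\<And>l. l \<noteq> 0 \<Longrightarrow> same_foliation \<Omega> (pullback (homothety l) \<Omega>)"
  shows "\<exists>n. \<forall>l v. l \<noteq> 0 \<longrightarrow> pullback (homothety l) \<Omega> v = l ^ n *s \<Omega> v"
proof -
  obtain i where i: "\<Omega> v0 $ i \<noteq> 0" using nz by (auto simp: vec_eq_iff)
  define e :: nat where "e = (if i = 3 then 0 else 1)"
  have pb: "pullback (homothety l) \<Omega> v $ i = l ^ e * \<Omega> (vector [l * v $ 1, l * v $ 2, v $ 3]) $ i" for l v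
    using exhaust_3[of i] by (auto simp: e_def pullback_homothety)
  obtain \<kappa> where \<kappa>: "\<And>l. l \<noteq> 0 \<Longrightarrow> \<kappa> l \<noteq> 0 \<and> (\<forall>v. pullback (homothety l) \<Omega> v = \<kappa> l *s \<Omega> v)"
    using inv unfolding same_foliation_def by metis
  have \<kappa>': "l ^ e * \<Omega> (vector [l * v $ 1, l * v $ 2, v $ 3]) $ i = \<kappa> l * \<Omega> v $ i" if "l \<noteq> 0" for l v
    using \<kappa>[OF that] by (simp add: pb[symmetric])
  have mult: "\<kappa> (l * m) = \<kappa> l * \<kappa> m" if "l \<noteq> 0" "m \<noteq> 0" for l m
  proof -
    have "\<kappa> (l * m) * \<Omega> v0 $ i = (l * m) ^ e * \<Omega> (vector [l * m * v0 $ 1, l * m * v0 $ 2, v0 $ 3]) $ i"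
      using \<kappa>'[of "l * m" v0] that by simp
    also have "\<dots> = m ^ e * (\<kappa> l * \<Omega> (vector [m * v0 $ 1, m * v0 $ 2, v0 $ 3]) $ i)"
      using \<kappa>'[OF that(1), of "vector [m * v0 $ 1, m * v0 $ 2, v0 $ 3]"]
      by (simp add: vector_3 power_mult_distrib mult_ac)
    also have "\<dots> = \<kappa> l * (\<kappa> m * \<Omega> v0 $ i)"
      using \<kappa>'[OF that(2), of v0] by (simp add: mult_ac)
    finally show ?thesis using i by simp
  qed
  obtain xs where xs: "\<And>v. \<Omega> v $ i = mono_sum xs v" using polynomial_fun_eq_mono_sum[OF pf] by blast
  define p where "p = smult (inverse (\<Omega> v0 $ i)) (monom 1 e *
    (\<Sum>(c, i, j, k)\<leftarrow>xs. monom (c * v0 $ 1 ^ i * v0 $ 2 ^ j * v0 $ 3 ^ k) (i + j)))"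
  have "poly (\<Sum>(c, i, j, k)\<leftarrow>xs. monom (c * v0 $ 1 ^ i * v0 $ 2 ^ j * v0 $ 3 ^ k) (i + j)) l =
      mono_sum xs (vector [l * v0 $ 1, l * v0 $ 2, v0 $ 3])" for l
    by (induction xs) (auto simp: poly_monom vector_3 power_mult_distrib power_add algebra_simps)
  then have p: "poly p l = \<kappa> l" if "l \<noteq> 0" for l
    using \<kappa>'[OF that, of v0] i by (simp add: p_def poly_monom xs[symmetric])
  have "p \<noteq> 0" using p[of 1] \<kappa>[of 1] by auto
  then obtain n where "\<And>l. l \<noteq> 0 \<Longrightarrow> \<kappa> l = l ^ n"
    using polynomial_character[of p] mult p by auto
  then show ?thesis using \<kappa> by metis
qed

section \<open>Common factors of binary quadratic forms\<close>

lemma binary_quadratic_common_root: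
  fixes a0 a1 a2 b0 b1 b2 :: complex
  assumes "a1 ^ 2 = 4 * a0 * a2" "b1 ^ 2 = 4 * b0 * b2" "a1 * b1 = 2 * (a0 * b2 + a2 * b0)"
  shows "\<exists>x y. (x \<noteq> 0 \<or> y \<noteq> 0) \<and> a0 * x ^ 2 + a1 * x * y + a2 * y ^ 2 = 0 \<and>
    b0 * x ^ 2 + b1 * x * y + b2 * y ^ 2 = 0"
proof -
  have a: "a1 * a1 = 4 * (a0 * a2)" and b: "b1 * b1 = 4 * (b0 * b2)"
    using assms by (simp_all add: power2_eq_square)
  consider "a0 \<noteq> 0" | "a2 \<noteq> 0" | "a0 = 0" "a2 = 0" "b0 \<noteq> 0" | "a0 = 0" "a2 = 0" "b2 \<noteq> 0"
    | "a0 = 0" "a2 = 0" "b0 = 0" "b2 = 0" by blast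
  then show ?thesis
  proof cases
    case 1
    \<comment> \<open>The point (- a1, 2 a0) annihilates the X-derivative of A and is its double
      root; the value of B there is 2 a0 (2 (a0 b2 + a2 b0) - a1 b1), zero by the mixed condition.
      The other cases use the Y-derivative, or B in place of A when A = 0.\<close>
    have "a0 * (- a1) ^ 2 + a1 * (- a1) * (2 * a0) + a2 * (2 * a0) ^ 2 = 0"
      "b0 * (- a1) ^ 2 + b1 * (- a1) * (2 * a0) + b2 * (2 * a0) ^ 2 = 0"
      using a assms(3) by algebra+
    with 1 show ?thesis by (intro exI[of _ "- a1"] exI[of _ "2 * a0"]) simp
  next
    case 2
    have "a0 * (2 * a2) ^ 2 + a1 * (2 * a2) * (- a1) + a2 * (- a1) ^ 2 = 0"
      "b0 * (2 * a2) ^ 2 + b1 * (2 * a2) * (- a1) + b2 * (- a1) ^ 2 = 0"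
      using a assms(3) by algebra+
    with 2 show ?thesis by (intro exI[of _ "2 * a2"] exI[of _ "- a1"]) simp
  next
    case 3
    then have "a1 = 0" using a by simp
    moreover have "b0 * (- b1) ^ 2 + b1 * (- b1) * (2 * b0) + b2 * (2 * b0) ^ 2 = 0"
      using b by algebra
    ultimately show ?thesis using 3 by (intro exI[of _ "- b1"] exI[of _ "2 * b0"]) simp
  next
    case 4
    then have "a1 = 0" using a by simp
    moreover have "b0 * (2 * b2) ^ 2 + b1 * (2 * b2) * (- b1) + b2 * (- b1) ^ 2 = 0"
      using b by algebra
    ultimately show ?thesis using 4 by (intro exI[of _ "2 * b2"] exI[of _ "- b1"]) simp
  next
    case 5
    then have "a1 = 0" "b1 = 0" using a b by simp_all
    with 5 show ?thesis by (intro exI[of _ 1] exI[of _ 0]) simp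
  qed
qed

lemma binary_quadratic_factor:
  fixes a0 a1 a2 x0 y0 :: complex
  assumes "a0 * x0 ^ 2 + a1 * x0 * y0 + a2 * y0 ^ 2 = 0" "x0 \<noteq> 0 \<or> y0 \<noteq> 0"
  shows "\<exists>u w. \<forall>x y. a0 * x ^ 2 + a1 * x * y + a2 * y ^ 2 = (y0 * x - x0 * y) * (u * x + w * y)"
proof (cases "y0 = 0")
  case True
  with assms have "a0 = 0" "x0 \<noteq> 0" by auto
  then show ?thesis
    by (intro exI[of _ "- a1 / x0"] exI[of _ "- a2 / x0"]) (simp add: True field_simps power2_eq_square)
next
  case False
  \<comment> \<open>Comparing coefficients of x^2 and x y determines the quotient; the remaining
    coefficient then agrees because (x0, y0) is a root.\<close>
  define u w where "u = a0 / y0" "w = (a1 + x0 * u) / y0"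
  have 0: "a0 = y0 * u" and 1: "a1 = y0 * w - x0 * u" using False by (simp_all add: u_w_def)
  have "y0 ^ 2 * (a2 + x0 * w) = 0"
    using assms(1) unfolding 0 1 by (simp add: algebra_simps power2_eq_square)
  then have 2: "a2 = - (x0 * w)" using False by (simp add: eq_neg_iff_add_eq_0)
  show ?thesis
    unfolding 0 1 2 by (intro exI[of _ u] exI[of _ w]) (simp add: algebra_simps power2_eq_square)
qed

section \<open>Weight of the form and its normal form\<close>

text \<open>
  Here \<open>l\<^sup>n\<close> is the factor by which the homothety of ratio \<open>l\<close> scales \<open>\<Omega>\<close>.
  For \<open>n < 3\<close> they are all divisible by \<open>Z\<close>; for \<open>n > 3\<close> the \<open>dZ\<close> coefficient vanishes and the Euler
  relation \<open>a X + b Y = 0\<close> makes \<open>a\<close> and \<open>b\<close> multiples of a common quadratic form.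
\<close>

lemma homothety_weight_eq_3:
  assumes fol: "foliation 2 \<Omega>"
    and xs: "\<And>v. \<Omega> v $ 1 = mono_sum xs1 v" "\<And>v. \<Omega> v $ 2 = mono_sum xs2 v" "\<And>v. \<Omega> v $ 3 = mono_sum xs3 v"
    and deg: "\<forall>(c, i, j, k)\<in>set xs1. i + j + k = 3 \<and> 1 + i + j = n"
      "\<forall>(c, i, j, k)\<in>set xs2. i + j + k = 3 \<and> 1 + i + j = n"
      "\<forall>(c, i, j, k)\<in>set xs3. i + j + k = 3 \<and> i + j = n"
  shows "n = 3"
proof (rule ccontr)
  assume "n \<noteq> 3"
  have ncf: "no_common_factor \<Omega>" using fol by (simp add: foliation_def)
  from \<open>n \<noteq> 3\<close> consider "n < 3" | "n > 3" by linarith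
  then show False
  proof cases
    case 1
    have "\<forall>(c, i, j, k)\<in>set xs1. k > 0" "\<forall>(c, i, j, k)\<in>set xs2. k > 0" "\<forall>(c, i, j, k)\<in>set xs3. k > 0"
      using 1 deg by fastforce+
    note mono_sum_third_coord[OF this(1), folded xs(1)] mono_sum_third_coord[OF this(2), folded xs(2)]
      mono_sum_third_coord[OF this(3), folded xs(3)]
    from no_common_factor_third_coord[OF ncf this] polynomial_fun_mono_sum show False by blast
  next
    case 2
    have d12: "\<forall>(c, i, j, k)\<in>set xs1. i + j = 3 \<and> k = 0" "\<forall>(c, i, j, k)\<in>set xs2. i + j = 3 \<and> k = 0"
      using 2 deg by fastforce+
    have "xs3 = []"
      using 2 deg(3) by (cases xs3) auto
    then have \<Omega>3: "\<Omega> v $ 3 = 0" for v by (simp add: xs)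
    obtain a0 a1 a2 a3 where a: "\<And>v. \<Omega> v $ 1 =
        a0 * v $ 1 ^ 3 + a1 * v $ 1 ^ 2 * v $ 2 + a2 * v $ 1 * v $ 2 ^ 2 + a3 * v $ 2 ^ 3"
      using mono_sum_cubic[OF d12(1)] xs by auto
    obtain b0 b1 b2 b3 where b: "\<And>v. \<Omega> v $ 2 =
        b0 * v $ 1 ^ 3 + b1 * v $ 1 ^ 2 * v $ 2 + b2 * v $ 1 * v $ 2 ^ 2 + b3 * v $ 2 ^ 3"
      using mono_sum_cubic[OF d12(2)] xs by auto
    have euler: "\<Omega> v $ 1 * v $ 1 + \<Omega> v $ 2 * v $ 2 = 0" for v
      using fol \<Omega>3 by (simp add: foliation_def sum_3)
    have "poly [:b3, a3 + b2, a2 + b1, a1 + b0, a0:] x = 0" for x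
      using euler[of "vector [x, 1, 0]"] unfolding a b
      by (simp add: vector_3 algebra_simps power2_eq_square power3_eq_cube)
    then have "[:b3, a3 + b2, a2 + b1, a1 + b0, a0:] = 0"
      by (intro poly_eq_poly_eq_iff[THEN iffD1] ext) simp
    then have c: "b3 = 0" "b2 = - a3" "b1 = - a2" "b0 = - a1" "a0 = 0"
      by (simp_all add: eq_neg_iff_add_eq_0 add.commute)
    \<comment> \<open>The form has become G (Y dX - X dY), so \<open>G\<close> is a common factor;
      being constant and zero at the origin, it vanishes.\<close>
    define G where "G v = a1 * v $ 1 ^ 2 + a2 * v $ 1 * v $ 2 + a3 * v $ 2 ^ 2" for v :: "complex^3"
    define h where "h i v = (if i = 1 then v $ 2 else if i = 2 then (-1) * v $ 1 else 0)"
      for i :: 3 and v :: "complex^3"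
    have ph: "polynomial_fun (h i)" for i
      using exhaust_3[of i] by (auto simp: h_def[abs_def] intro!: polynomial_fun.intros
        polynomial_fun.mult[OF polynomial_fun.const polynomial_fun.coord, of "-1", simplified])
    have pG: "polynomial_fun G"
      unfolding G_def by (intro polynomial_fun.intros polynomial_fun_power)
    have \<Omega>h: "\<Omega> v $ i = G v * h i v" for v i
      using exhaust_3[of i]
      by (auto simp: a b \<Omega>3 c G_def h_def algebra_simps power2_eq_square power3_eq_cube)
    have "G v = 0" for v
      using no_common_factorD[OF ncf pG ph \<Omega>h, of v 0] by (simp add: G_def)
    then have "\<Omega> v $ i = 0" for v i using \<Omega>h by simp
    then show False
      using no_common_factor_third_coord[OF ncf, of "\<lambda>_. 0" "\<lambda>_. 0" "\<lambda>_. 0"] polynomial_fun.const by simp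
  qed
qed

lemma homogeneous_foliation_normal_form:
  assumes fol: "foliation 2 \<Omega>"
    and inv: "\<And>l. l \<noteq> 0 \<Longrightarrow> same_foliation \<Omega> (pullback (homothety l) \<Omega>)"
  obtains a0 a1 a2 b0 b1 b2 where
    "\<And>v. \<Omega> v $ 1 = v $ 3 * (a0 * v $ 1 ^ 2 + a1 * v $ 1 * v $ 2 + a2 * v $ 2 ^ 2)"
    "\<And>v. \<Omega> v $ 2 = v $ 3 * (b0 * v $ 1 ^ 2 + b1 * v $ 1 * v $ 2 + b2 * v $ 2 ^ 2)"
    "\<And>v. \<Omega> v $ 3 = - (v $ 1 * (a0 * v $ 1 ^ 2 + a1 * v $ 1 * v $ 2 + a2 * v $ 2 ^ 2) +
      v $ 2 * (b0 * v $ 1 ^ 2 + b1 * v $ 1 * v $ 2 + b2 * v $ 2 ^ 2))"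
proof -
  have ncf: "no_common_factor \<Omega>" and pf: "\<And>i. polynomial_fun (\<lambda>v. \<Omega> v $ i)"
    and hom: "\<And>i t v. \<Omega> (t *s v) $ i = t ^ 3 * \<Omega> v $ i"
    using fol by (auto simp: foliation_def homogeneous_poly_def numeral_3_eq_3)
  obtain v0 where "\<Omega> v0 \<noteq> 0"
    using no_common_factor_third_coord[OF ncf, of "\<lambda>_. 0" "\<lambda>_. 0" "\<lambda>_. 0"] polynomial_fun.const
    by (metis mult_zero_right zero_index)
  from homothety_character[OF pf this inv]
  obtain n where n: "\<And>l v. l \<noteq> 0 \<Longrightarrow> pullback (homothety l) \<Omega> v = l ^ n *s \<Omega> v" by blast
  have s: "l ^ 1 * \<Omega> (vector [l * v $ 1, l * v $ 2, v $ 3]) $ 1 = l ^ n * \<Omega> v $ 1"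
    "l ^ 1 * \<Omega> (vector [l * v $ 1, l * v $ 2, v $ 3]) $ 2 = l ^ n * \<Omega> v $ 2"
    "l ^ 0 * \<Omega> (vector [l * v $ 1, l * v $ 2, v $ 3]) $ 3 = l ^ n * \<Omega> v $ 3" if "l \<noteq> 0" for l v
    using pullback_homothety[of l \<Omega> v] n[OF that, of v] by simp_all
  obtain xs1 where xs1: "\<And>v. \<Omega> v $ 1 = mono_sum xs1 v" "\<forall>(c, i, j, k)\<in>set xs1. i + j + k = 3 \<and> 1 + i + j = n"
    using mono_sum_bihomogeneous[OF pf hom s(1)] by blast
  obtain xs2 where xs2: "\<And>v. \<Omega> v $ 2 = mono_sum xs2 v" "\<forall>(c, i, j, k)\<in>set xs2. i + j + k = 3 \<and> 1 + i + j = n"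
    using mono_sum_bihomogeneous[OF pf hom s(2)] by blast
  obtain xs3 where xs3: "\<And>v. \<Omega> v $ 3 = mono_sum xs3 v" "\<forall>(c, i, j, k)\<in>set xs3. i + j + k = 3 \<and> 0 + i + j = n"
    using mono_sum_bihomogeneous[OF pf hom s(3)] by blast
  have n3: "n = 3"
    using homothety_weight_eq_3[OF fol xs1(1) xs2(1) xs3(1) xs1(2) xs2(2)] xs3(2) by simp
  have d12: "\<forall>(c, i, j, k)\<in>set xs1. i + j = 2 \<and> k = 1" "\<forall>(c, i, j, k)\<in>set xs2. i + j = 2 \<and> k = 1"
    using n3 xs1(2) xs2(2) by fastforce+
  have d3: "\<forall>(c, i, j, k)\<in>set xs3. i + j = 3 \<and> k = 0"
    using n3 xs3(2) by fastforce
  obtain a0 a1 a2 where a: "\<And>v. \<Omega> v $ 1 = v $ 3 * (a0 * v $ 1 ^ 2 + a1 * v $ 1 * v $ 2 + a2 * v $ 2 ^ 2)"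
    using mono_sum_quadratic[OF d12(1)] xs1(1) by auto
  obtain b0 b1 b2 where b: "\<And>v. \<Omega> v $ 2 = v $ 3 * (b0 * v $ 1 ^ 2 + b1 * v $ 1 * v $ 2 + b2 * v $ 2 ^ 2)"
    using mono_sum_quadratic[OF d12(2)] xs2(1) by auto
  obtain c0 c1 c2 c3 where c: "\<And>v. \<Omega> v $ 3 =
      c0 * v $ 1 ^ 3 + c1 * v $ 1 ^ 2 * v $ 2 + c2 * v $ 1 * v $ 2 ^ 2 + c3 * v $ 2 ^ 3"
    using mono_sum_cubic[OF d3] xs3(1) by auto
  have euler: "\<Omega> v $ 1 * v $ 1 + \<Omega> v $ 2 * v $ 2 + \<Omega> v $ 3 * v $ 3 = 0" for v
    using fol by (simp add: foliation_def sum_3)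
  have "\<Omega> v $ 3 = - (v $ 1 * (a0 * v $ 1 ^ 2 + a1 * v $ 1 * v $ 2 + a2 * v $ 2 ^ 2) +
      v $ 2 * (b0 * v $ 1 ^ 2 + b1 * v $ 1 * v $ 2 + b2 * v $ 2 ^ 2))" for v
  proof -
    \<comment> \<open>The Euler relation determines only Z times this coefficient; as the
      coefficient is free of Z, it can be read off at Z = 1.\<close>
    have "\<Omega> v $ 3 = \<Omega> (vector [v $ 1, v $ 2, 1]) $ 3" by (simp add: c vector_3)
    also have "\<dots> = - (v $ 1 * (a0 * v $ 1 ^ 2 + a1 * v $ 1 * v $ 2 + a2 * v $ 2 ^ 2) +
      v $ 2 * (b0 * v $ 1 ^ 2 + b1 * v $ 1 * v $ 2 + b2 * v $ 2 ^ 2))"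
      using euler[of "vector [v $ 1, v $ 2, 1]"]
      by (intro eq_neg_iff_add_eq_0[THEN iffD2]) (simp add: a b vector_3 mult.commute add.commute)
    finally show ?thesis .
  qed
  with a b that show ?thesis by blast
qed

lemma homogeneous_foliation_flat:
  assumes fol: "foliation 2 \<Omega>"
    and inv: "\<And>l. l \<noteq> 0 \<Longrightarrow> same_foliation \<Omega> (pullback (homothety l) \<Omega>)"
  shows "flat_web (leg_line (vector [0, 0, 1]) \<boxtimes> leg_foliation 2 \<Omega>)"
proof -
  have ncf: "no_common_factor \<Omega>" using fol by (simp add: foliation_def)
  obtain a0 a1 a2 b0 b1 b2 where
    a: "\<And>v. \<Omega> v $ 1 = v $ 3 * (a0 * v $ 1 ^ 2 + a1 * v $ 1 * v $ 2 + a2 * v $ 2 ^ 2)" and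
    b: "\<And>v. \<Omega> v $ 2 = v $ 3 * (b0 * v $ 1 ^ 2 + b1 * v $ 1 * v $ 2 + b2 * v $ 2 ^ 2)" and
    c: "\<And>v. \<Omega> v $ 3 = - (v $ 1 * (a0 * v $ 1 ^ 2 + a1 * v $ 1 * v $ 2 + a2 * v $ 2 ^ 2) +
      v $ 2 * (b0 * v $ 1 ^ 2 + b1 * v $ 1 * v $ 2 + b2 * v $ 2 ^ 2))"
    by (rule homogeneous_foliation_normal_form[OF fol inv], assumption) (rule that)
  show ?thesis
  proof (rule flat_web_legendre)
    show "\<Omega> (vector [x, y, 1]) $ 1 = a0 * x ^ 2 + a1 * x * y + a2 * y ^ 2"
      "\<Omega> (vector [x, y, 1]) $ 2 = b0 * x ^ 2 + b1 * x * y + b2 * y ^ 2" for x y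
      by (simp_all add: a b vector_3)
    show "[:a0, a1 + b0, a2 + b1, b2:] \<noteq> 0"
    proof
      assume "[:a0, a1 + b0, a2 + b1, b2:] = 0"
      then have z: "a0 = 0" "b0 = - a1" "b1 = - a2" "b2 = 0"
        by (simp_all add: eq_neg_iff_add_eq_0 add.commute)
      \<comment> \<open>\<open>P\<close> = 0 means that X A + Y B vanishes identically, so Z divides
        all three coefficients.\<close>
      have "\<Omega> v $ 3 = v $ 3 * 0" for v
        unfolding c z by (simp add: algebra_simps power2_eq_square)
      then show False
        by (rule no_common_factor_third_coord[OF ncf a b])
          (intro polynomial_fun.intros polynomial_fun_power)+
    qed
    show "[:a1 ^ 2 - 4 * a0 * a2, 2 * a1 * b1 - 4 * (a0 * b2 + a2 * b0), b1 ^ 2 - 4 * b0 * b2:] \<noteq> 0"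
    proof
      assume "[:a1 ^ 2 - 4 * a0 * a2, 2 * a1 * b1 - 4 * (a0 * b2 + a2 * b0), b1 ^ 2 - 4 * b0 * b2:] = 0"
      then have disc: "a1 ^ 2 = 4 * a0 * a2" "b1 ^ 2 = 4 * b0 * b2" "2 * a1 * b1 = 4 * (a0 * b2 + a2 * b0)"
        by simp_all
      from disc(3) have "a1 * b1 = 2 * (a0 * b2 + a2 * b0)" by algebra
      from binary_quadratic_common_root[OF disc(1,2) this] obtain x0 y0 where
        r: "x0 \<noteq> 0 \<or> y0 \<noteq> 0" "a0 * x0 ^ 2 + a1 * x0 * y0 + a2 * y0 ^ 2 = 0"
          "b0 * x0 ^ 2 + b1 * x0 * y0 + b2 * y0 ^ 2 = 0" by blast
      obtain u w where A: "\<And>x y. a0 * x ^ 2 + a1 * x * y + a2 * y ^ 2 = (y0 * x - x0 * y) * (u * x + w * y)"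
        using binary_quadratic_factor[OF r(2,1)] by blast
      obtain u' w' where B: "\<And>x y. b0 * x ^ 2 + b1 * x * y + b2 * y ^ 2 = (y0 * x - x0 * y) * (u' * x + w' * y)"
        using binary_quadratic_factor[OF r(3,1)] by blast
      \<comment> \<open>If the discriminant of the pencil vanishes, A and B share a root, and the
        linear form \<open>L\<close> vanishing there divides \<Omega>.\<close>
      define L where "L v = y0 * v $ 1 + (- x0) * v $ 2" for v :: "complex^3"
      define h where "h i v = (if i = 1 then v $ 3 * (u * v $ 1 + w * v $ 2)
        else if i = 2 then v $ 3 * (u' * v $ 1 + w' * v $ 2)
        else (- 1) * (v $ 1 * (u * v $ 1 + w * v $ 2) + v $ 2 * (u' * v $ 1 + w' * v $ 2)))"
        for i :: 3 and v :: "complex^3"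
      have ph: "polynomial_fun (h i)" for i
      proof -
        have pf: "polynomial_fun (\<lambda>v. v $ 3 * (u * v $ 1 + w * v $ 2))"
          "polynomial_fun (\<lambda>v. v $ 3 * (u' * v $ 1 + w' * v $ 2))"
          "polynomial_fun (\<lambda>v. (- 1) * (v $ 1 * (u * v $ 1 + w * v $ 2) + v $ 2 * (u' * v $ 1 + w' * v $ 2)))"
          by (intro polynomial_fun.intros)+
        show ?thesis
          unfolding h_def[abs_def]
          by (cases "i = 1", simp_all only: pf if_True if_False simp_thms)
            (cases "i = 2", simp_all only: pf if_True if_False simp_thms)
      qed
      have pL: "polynomial_fun L" unfolding L_def by (intro polynomial_fun.intros)
      have \<Omega>h: "\<Omega> v $ i = L v * h i v" for v i
      proof -
        have "\<Omega> v $ 1 = L v * h 1 v" "\<Omega> v $ 2 = L v * h 2 v" "\<Omega> v $ 3 = L v * h 3 v"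
          unfolding a b c A B by (simp_all add: L_def h_def algebra_simps)
        then show ?thesis using exhaust_3[of i] by auto
      qed
      note L = no_common_factorD[OF ncf pL ph \<Omega>h, where v = 0]
      show False
        using L[of "axis 1 1"] L[of "axis 2 1"] r(1) by (simp add: L_def axis_def)
    qed
  qed
qed

theorem corollary3p2:
  fixes \<omega> :: "complex^3 \<Rightarrow> complex^3" and M :: "complex^3^3"
  assumes "foliation 2 \<omega>"
    and "invertible M"
    and "homogeneous_in_chart M \<omega>"
  shows "flat_web (leg_prefoliation M 2 (line_at_infinity M, \<omega>))"
proof -
  \<comment> \<open>In the chart \<open>M\<close> the line at infinity becomes Z = 0, so its
    Legendre transform is dp.\<close>
  have "(transpose M *v line_at_infinity M) $ i = (matrix_inv M ** M) $ 3 $ i" for i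
    by (simp add: line_at_infinity_def matrix_vector_mult_def transpose_def matrix_matrix_mult_def
        mult.commute del: transpose_matrix_vector)
  then have "transpose M *v line_at_infinity M = vector [0, 0, 1]"
    unfolding matrix_inv_mult(2)[OF assms(2)]
    by (simp add: vec_eq_iff forall_3 vector_3 mat_def del: transpose_matrix_vector)
  moreover have "flat_web (leg_line (vector [0, 0, 1]) \<boxtimes> leg_foliation 2 (pullback M \<omega>))"
    using homogeneous_foliation_flat[OF foliation_pullback[OF assms(1,2)]] assms(3)
    unfolding homogeneous_in_chart_def by blast
  ultimately show ?thesis
    unfolding leg_prefoliation_def fst_conv snd_conv by (simp only:)
qed

end
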